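(* Let $k,\ell\ge1$ and let $\lambda\in\hat{\mathrm P}^k_\ell$. Then there are integers $b_{\lambda\mu}$, indexed by $k$-bounded partitions $\mu$ and only finitely many nonzero, such that $$\tilde g^{(k)}_\lambda=\sum_{\mu}b_{\lambda\mu}\,g^{(k)}_\mu,\qquad (-1)^{|\lambda|-|\mu|}b_{\lambda\mu}\in\mathbb Z_{\ge0}\text{ for all }\mu.$$
   Context: Notation: $[a,b]=\{a,\dots,b\}$, $[b]=[1,b]$; $\epsilon_i\in\mathbb Z^\ell$ is the $i$-th unit vector; $|\gamma|=\sum_i\gamma_i$. $h_m$ is the complete homogeneous symmetric function ($h_0=1$, $h_m=0$ for $m<0$). For $m\in\mathbb Z$, $r\in\mathbb Z_{\ge0}$ put $k^{(r)}_m=\sum_{i=0}^{m}\binom{r+i-1}{i}h_{m-i}$, with $k^{(r)}_m=0$ for $m<0$, $k^{(0)}_m=h_m$. For $\gamma\in\mathbb Z^\ell$ let $g_\gamma=\det(k^{(i-1)}_{\gamma_i+j-i})_{1\le i,j\le\ell}$. $\Delta^+_\ell=\{(i,j):1\le i<j\le\ell\}$ with $(a,b)\le(c,d)$ iff $a\ge c$, $b\le d$; a root ideal is an upper order ideal of $\Delta^+_\ell$. For a root ideal $\Psi$, a multiset $M$ on $[\ell]$ and $\gamma\in\mathbb Z^\ell$, the Katalan function is $K(\Psi;M;\gamma)=\prod_{z\in M}(1-L_z)\prod_{(i,j)\in\Psi}(1-R_{ij})^{-1}g_\gamma$, with operators acting on indices: $L_zg_\gamma=g_{\gamma-\epsilon_z}$,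 $R_{ij}g_\gamma=g_{\gamma+\epsilon_i-\epsilon_j}$, $(1-R_{ij})^{-1}=\sum_{n\ge0}R_{ij}^n$. $\mathrm P^k_\ell$ is the set of $k$-bounded partitions with at most $\ell$ parts, written as $\ell$-tuples $\lambda_1\ge\cdots\ge\lambda_\ell\ge0$, $\lambda_1\le k$. For $\lambda\in\mathrm P^k_\ell$, $\Delta^k(\lambda)=\{(i,j)\in\Delta^+_\ell:k-\lambda_i+i<j\}$, and $L(\mathcal R)$ denotes the multiset of second coordinates of the elements of $\mathcal R\subseteq\Delta^+_\ell$. $\hat{\mathrm P}^k_\ell:=\{\lambda\in\mathrm P^k_\ell:\ \lambda_{x-1}>\lambda_x \text{ whenever } k-\lambda_x+x<\ell\}$, with the convention $\lambda_0=\infty$ (it contains all strictly decreasing $\lambda\in\mathrm P^k_\ell$). The closed $k$-Schur Katalan function is $\tilde g^{(k)}_\lambda:=K(\Delta^k(\lambda);L(\Delta^k(\lambda));\lambda)$. $g^{(k)}_\mu$ is the $K$-$k$-Schur function (Lam–Schilling–Shimozono) of a $k$-bounded partition $\mu$; by a theorem of Blasiak–Morse–Seelinger, for $\mu\in\mathrm P^k_\ell$ it equals $K(\Delta^k(\mu);L(\Delta^{k+1}(\mu));\mu)$. *)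

theory Defs
  imports "HOL-Library.Multiset" "Jordan_Normal_Form.Determinant"
begin

section \<open>The ring of symmetric functions\<close>

text \<open>
  A monomial in the variables \<open>x\<^sub>0, x\<^sub>1, \<dots>\<close> is encoded as the finite multiset of the indices of
  its variables. A symmetric function is a formal power series of bounded degree with integer
  coefficients, given by its coefficient function, that is invariant under permuting the variables.
\<close>

lemma finite_submultisets: "finite {A. A \<subseteq># M}"
proof (induction M)
  case (add x M)
  have "{A. A \<subseteq># add_mset x M} \<subseteq> {A. A \<subseteq># M} \<union> add_mset x ` {A. A \<subseteq># M}"
  proof
    fix A assume "A \<in> {A. A \<subseteq># add_mset x M}"
    then have A: "A \<subseteq># add_mset x M" by simp
    show "A \<in> {A. A \<subseteq># M} \<union> add_mset x ` {A. A \<subseteq># M}"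
    proof (cases "x \<in># A")
      case True
      then obtain B where B: "A = add_mset x B" by (metis insert_DiffM)
      with A show ?thesis by auto
    next
      case False
      with A have "A \<subseteq># M"
        by (metis add_mset_remove_trivial diff_single_trivial subset_eq_diff_conv
            add_mset_add_single)
      then show ?thesis by simp
    qed
  qed
  with add show ?case by (meson finite_Un finite_imageI finite_subset)
qed simp

lemma finite_mset_pairs: "finite {(A, B). A + B = (M :: 'a multiset)}"
  by (rule finite_subset[of _ "{A. A \<subseteq># M} \<times> {A. A \<subseteq># M}"]) (auto simp: finite_submultisets)

typedef symfun =
  "{f :: nat multiset \<Rightarrow> int. (\<forall>\<pi> M. bij \<pi> \<longrightarrow> f (image_mset \<pi> M) = f M) \<and>
     (\<exists>d. \<forall>M. d < size M \<longrightarrow> f M = 0)}"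
  morphisms sf_coeff Abs_symfun
  by (rule exI[of _ "\<lambda>_. 0"]) simp

setup_lifting type_definition_symfun

lemma symfun_eqI: "(\<And>M. sf_coeff f M = sf_coeff g M) \<Longrightarrow> f = g"
  by transfer auto

instantiation symfun :: comm_ring_1
begin

lift_definition zero_symfun :: symfun is "\<lambda>_. 0" by simp

lift_definition one_symfun :: symfun is "\<lambda>M. if M = {#} then 1 else 0"
  by (auto intro: exI[of _ 0])

lift_definition plus_symfun :: "symfun \<Rightarrow> symfun \<Rightarrow> symfun" is "\<lambda>f g M. f M + g M"
proof goal_cases
  case (1 f g)
  then obtain d e where "\<forall>M. d < size M \<longrightarrow> f M = 0" "\<forall>M. e < size M \<longrightarrow> g M = 0" by blast
  then have "\<forall>M. max d e < size M \<longrightarrow> f M + g M = 0" by simp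
  with 1 show ?case by (intro CollectI conjI exI[of _ "max d e"]) auto
qed

lift_definition uminus_symfun :: "symfun \<Rightarrow> symfun" is "\<lambda>f M. - f M" by auto

definition minus_symfun :: "symfun \<Rightarrow> symfun \<Rightarrow> symfun" where
  "minus_symfun f g = f + - g"

lift_definition times_symfun :: "symfun \<Rightarrow> symfun \<Rightarrow> symfun"
  is "\<lambda>f g M. \<Sum>(A, B) | A + B = M. f A * g B"
proof goal_cases
  case (1 f g)
  then obtain d e where d: "\<forall>M. d < size M \<longrightarrow> f M = 0" and e: "\<forall>M. e < size M \<longrightarrow> g M = 0"
    by blast
  have "(\<Sum>(A, B) | A + B = M. f A * g B) = 0" if "d + e < size M" for M
  proof (rule sum.neutral, safe)
    fix A B :: "nat multiset" assume "M = A + B"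
    with that have "d < size A \<or> e < size B" by auto
    then show "f A * g B = 0" using d e by auto
  qed
  moreover have "(\<Sum>(A, B) | A + B = image_mset \<pi> M. f A * g B) = (\<Sum>(A, B) | A + B = M. f A * g B)"
    if \<pi>: "bij \<pi>" for \<pi> M
  proof -
    have [simp]: "image_mset \<pi> (image_mset (inv_into UNIV \<pi>) A) = A"
      "image_mset (inv_into UNIV \<pi>) (image_mset \<pi> A) = A" for A
      using \<pi> by (simp_all add: multiset.map_comp bij_is_surj bij_is_inj comp_def
          surj_f_inv_f[OF bij_is_surj])
    have "bij (inv_into UNIV \<pi>)" using \<pi> by (rule bij_imp_bij_inv)
    with 1 show ?thesis
      by (intro sum.reindex_bij_witness[where
            i = "\<lambda>(A, B). (image_mset \<pi> A, image_mset \<pi> B)" and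
            j = "\<lambda>(A, B). (image_mset (inv_into UNIV \<pi>) A, image_mset (inv_into UNIV \<pi>) B)"])
        (auto simp flip: image_mset_union)
  qed
  ultimately show ?case by blast
qed

instance
proof
  fix a b c :: symfun
  show "a * b * c = a * (b * c)"
  proof (rule symfun_eqI)
    fix M
    let ?T = "\<Sum>(A, B, C) | A + B + C = M. sf_coeff a A * sf_coeff b B * sf_coeff c C"
    have "sf_coeff (a * b * c) M = (\<Sum>(N, C) | N + C = M. \<Sum>(A, B) | A + B = N.
        sf_coeff a A * sf_coeff b B * sf_coeff c C)"
      by (simp add: times_symfun.rep_eq sum_distrib_right case_prod_unfold)
    also have "\<dots> = (\<Sum>(p, q) \<in> (SIGMA p : {(N, C). N + C = M}. {(A, B). A + B = fst p}).
        sf_coeff a (fst q) * sf_coeff b (snd q) * sf_coeff c (snd p))"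
      by (subst sum.Sigma[symmetric]) (use finite_mset_pairs in \<open>auto simp: case_prod_unfold\<close>)
    also have "\<dots> = ?T"
      by (rule sum.reindex_bij_witness[where
            i = "\<lambda>(A, B, C). ((A + B, C), (A, B))" and j = "\<lambda>(p, q). (fst q, snd q, snd p)"]) auto
    finally have 1: "sf_coeff (a * b * c) M = ?T" .
    have "sf_coeff (a * (b * c)) M = (\<Sum>(A, N) | A + N = M. \<Sum>(B, C) | B + C = N.
        sf_coeff a A * sf_coeff b B * sf_coeff c C)"
      by (simp add: times_symfun.rep_eq sum_distrib_left case_prod_unfold mult.assoc)
    also have "\<dots> = (\<Sum>(p, q) \<in> (SIGMA p : {(A, N). A + N = M}. {(B, C). B + C = snd p}).
        sf_coeff a (fst p) * sf_coeff b (fst q) * sf_coeff c (snd q))"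
      by (subst sum.Sigma[symmetric]) (use finite_mset_pairs in \<open>auto simp: case_prod_unfold\<close>)
    also have "\<dots> = ?T"
      by (rule sum.reindex_bij_witness[where
            i = "\<lambda>(A, B, C). ((A, B + C), (B, C))" and j = "\<lambda>(p, q). (fst p, fst q, snd q)"])
        (auto simp: ac_simps)
    finally show "sf_coeff (a * b * c) M = sf_coeff (a * (b * c)) M" using 1 by simp
  qed
  show "a * b = b * a"
    by (rule symfun_eqI, unfold times_symfun.rep_eq,
        rule sum.reindex_bij_witness[where i = "\<lambda>(A, B). (B, A)" and j = "\<lambda>(A, B). (B, A)"])
      (auto simp: ac_simps)
  show "1 * a = a"
  proof (rule symfun_eqI)
    fix M
    have "sf_coeff (1 * a) M = (\<Sum>(A, B) | A + B = M. if A = {#} then sf_coeff a B else 0)"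
      by (auto simp: times_symfun.rep_eq one_symfun.rep_eq intro!: sum.cong)
    also have "\<dots> = (\<Sum>(A, B) \<in> {({#} :: nat multiset, M)}. if A = {#} then sf_coeff a B else 0)"
      by (rule sum.mono_neutral_right) (auto simp: finite_mset_pairs split: if_splits)
    finally show "sf_coeff (1 * a) M = sf_coeff a M" by simp
  qed
  show "(a + b) * c = a * c + b * c"
    by (rule symfun_eqI)
      (simp add: times_symfun.rep_eq plus_symfun.rep_eq case_prod_unfold distrib_right sum.distrib)
  show "(0 :: symfun) \<noteq> 1"
    by (metis one_symfun.rep_eq zero_symfun.rep_eq zero_neq_one)
  show "a + b + c = a + (b + c)" "a + b = b + a" "0 + a = a" "- a + a = 0"
    by (simp_all add: symfun_eqI plus_symfun.rep_eq zero_symfun.rep_eq uminus_symfun.rep_eq)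
  show "a - b = a + - b" by (simp add: minus_symfun_def)
qed

end

lift_definition hsym :: "nat \<Rightarrow> symfun" is "\<lambda>m M. if size M = m then 1 else 0"
  by auto

section \<open>Katalan functions\<close>

text \<open>
  Truncated subtraction is harmless in the binomial coefficient: for \<open>r = i = 0\<close> both
  \<open>-1 choose 0\<close> and \<open>0 choose 0\<close> are \<open>1\<close>.
\<close>

definition kh :: "nat \<Rightarrow> int \<Rightarrow> symfun" where
  "kh r m = (if m < 0 then 0 else \<Sum>i = 0..nat m. of_nat ((r + i - 1) choose i) * hsym (nat m - i))"

text \<open>
  Elements of \<open>\<int>\<^sup>l\<close> are functions \<^typ>\<open>nat \<Rightarrow> int\<close> of which only the values on \<open>{1..l}\<close> matter.
  Matrices are indexed from \<open>0\<close>, so row \<open>i\<close> and column \<open>j\<close> here are row \<open>i + 1\<close> and column \<open>j + 1\<close>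
  of the usual determinant.
\<close>

definition gsym :: "nat \<Rightarrow> (nat \<Rightarrow> int) \<Rightarrow> symfun" where
  "gsym l \<gamma> = det (mat l l (\<lambda>(i, j). kh i (\<gamma> (i + 1) + int j - int i)))"

definition roots :: "nat \<Rightarrow> (nat \<times> nat) set" where
  "roots l = {(i, j). 1 \<le> i \<and> i < j \<and> j \<le> l}"

definition root_ideal :: "nat \<Rightarrow> (nat \<times> nat) set \<Rightarrow> bool" where
  "root_ideal l \<Psi> \<longleftrightarrow> \<Psi> \<subseteq> roots l \<and>
     (\<forall>(a, b) \<in> \<Psi>. \<forall>(c, d) \<in> roots l. c \<le> a \<and> b \<le> d \<longrightarrow> (c, d) \<in> \<Psi>)"

text \<open>
  Operators on indices act on families \<open>\<phi>\<close> indexed by \<open>\<int>\<^sup>l\<close>. The family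
  \<open>raising_series \<Psi> \<phi>\<close> is the result of applying \<open>\<Prod>\<^bsub>(i, j) \<in> \<Psi>\<^esub> (1 - R\<^sub>i\<^sub>j)\<^sup>-\<^sup>1\<close>, expanded as the sum
  over all exponent vectors \<open>n\<close> of \<open>\<Prod>\<^bsub>(i, j) \<in> \<Psi>\<^esub> R\<^sub>i\<^sub>j\<^bsup>n(i, j)\<^esup>\<close>; only the nonzero terms are summed, and
  for \<open>\<phi> = gsym l\<close> there are finitely many of them (lemma \<open>finite_raising_support\<close> below).
\<close>

definition raised :: "(nat \<times> nat) set \<Rightarrow> (nat \<times> nat \<Rightarrow> nat) \<Rightarrow> (nat \<Rightarrow> int) \<Rightarrow> nat \<Rightarrow> int" where
  "raised \<Psi> n \<gamma> x =
     \<gamma> x + (\<Sum>(i, j) \<in> \<Psi>. int (n (i, j)) * (of_bool (x = i) - of_bool (x = j)))"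

definition raising_series ::
  "(nat \<times> nat) set \<Rightarrow> ((nat \<Rightarrow> int) \<Rightarrow> symfun) \<Rightarrow> (nat \<Rightarrow> int) \<Rightarrow> symfun" where
  "raising_series \<Psi> \<phi> \<gamma> =
     (\<Sum>n | (\<forall>p. p \<notin> \<Psi> \<longrightarrow> n p = 0) \<and> \<phi> (raised \<Psi> n \<gamma>) \<noteq> 0. \<phi> (raised \<Psi> n \<gamma>))"

definition one_minus_L :: "nat \<Rightarrow> ((nat \<Rightarrow> int) \<Rightarrow> symfun) \<Rightarrow> (nat \<Rightarrow> int) \<Rightarrow> symfun" where
  "one_minus_L z \<phi> \<gamma> = \<phi> \<gamma> - \<phi> (\<gamma>(z := \<gamma> z - 1))"

definition katalan ::
  "nat \<Rightarrow> (nat \<times> nat) set \<Rightarrow> nat multiset \<Rightarrow> (nat \<Rightarrow> int) \<Rightarrow> symfun" where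
  "katalan l \<Psi> M \<gamma> = fold_mset one_minus_L (raising_series \<Psi> (gsym l)) M \<gamma>"

interpretation one_minus_L: comp_fun_commute one_minus_L
proof
  fix y x
  show "one_minus_L y \<circ> one_minus_L x = one_minus_L x \<circ> one_minus_L y"
    by (cases "x = y") (auto simp: fun_eq_iff one_minus_L_def fun_upd_twist)
qed

section \<open>Closed k-Schur Katalan functions and K-k-Schur functions\<close>

definition part :: "nat list \<Rightarrow> nat \<Rightarrow> int" where
  "part lam i = (if 1 \<le> i \<and> i \<le> length lam then int (lam ! (i - 1)) else 0)"

definition Pk :: "nat \<Rightarrow> nat \<Rightarrow> nat list set" where
  "Pk k l = {lam. length lam = l \<and> sorted_wrt (\<ge>) lam \<and> (\<forall>x \<in> set lam. x \<le> k)}"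

text \<open>The convention \<open>\<lambda>\<^sub>0 = \<infinity>\<close> makes the condition void for \<open>x = 1\<close>.\<close>

definition Pk_hat :: "nat \<Rightarrow> nat \<Rightarrow> nat list set" where
  "Pk_hat k l = {lam \<in> Pk k l.
     \<forall>x \<in> {2..l}. int k - part lam x + int x < int l \<longrightarrow> part lam (x - 1) > part lam x}"

text \<open>Partitions with an arbitrary number of parts are lists of their nonzero parts.\<close>

definition bounded_partitions :: "nat \<Rightarrow> nat list set" where
  "bounded_partitions k = {mu. sorted_wrt (\<ge>) mu \<and> (\<forall>x \<in> set mu. 1 \<le> x \<and> x \<le> k)}"

definition Delta :: "nat \<Rightarrow> nat list \<Rightarrow> (nat \<times> nat) set" where
  "Delta k lam = {(i, j) \<in> roots (length lam). int k - part lam i + int i < int j}"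

definition Lset :: "(nat \<times> nat) set \<Rightarrow> nat multiset" where
  "Lset R = image_mset snd (mset_set R)"

definition closed_k_Schur_Katalan :: "nat \<Rightarrow> nat list \<Rightarrow> symfun" where
  "closed_k_Schur_Katalan k lam =
     katalan (length lam) (Delta k lam) (Lset (Delta k lam)) (part lam)"

text \<open>
  The Blasiak--Morse--Seelinger raising operator formula for the K-k-Schur function of Lam,
  Schilling and Shimozono. The value is the same for every tuple that represents the partition,
  whatever the number of trailing zeros (lemma \<open>K_k_Schur_pad\<close> below).
\<close>

definition K_k_Schur :: "nat \<Rightarrow> nat list \<Rightarrow> symfun" where
  "K_k_Schur k mu = katalan (length mu) (Delta k mu) (Lset (Delta (k + 1) mu)) (part mu)"

section \<open>Well-definedness\<close>

lemma finite_roots: "finite (roots l)"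
  by (rule finite_subset[of _ "{..l} \<times> {..l}"]) (auto simp: roots_def)

lemma Delta_subset_roots: "Delta k lam \<subseteq> roots (length lam)"
  by (auto simp: Delta_def)

lemma finite_Delta: "finite (Delta k lam)"
  using Delta_subset_roots finite_roots by (rule finite_subset)

lemma root_ideal_Delta:
  assumes "lam \<in> Pk k l"
  shows "root_ideal l (Delta k lam)"
proof -
  have "part lam a \<le> part lam c" if "1 \<le> c" "c \<le> a" "a \<le> l" for a c
    using assms that by (cases "c = a") (auto simp: Pk_def part_def sorted_wrt_iff_nth_less)
  then show ?thesis
    using assms by (fastforce simp: root_ideal_def Delta_def roots_def Pk_def)
qed

lemma perm_tail_sum_le:
  assumes p: "p permutes {0..<l}"
  shows "(\<Sum>i \<in> {a..<l}. int (p i)) \<le> (\<Sum>i \<in> {a..<l}. int i)"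
proof -
  define T where "T = {a..<l}"
  define S where "S = p ` T"
  have inj: "inj_on p T" using p permutes_inj inj_on_subset by blast
  have fin: "finite T" "finite S" by (auto simp: T_def S_def)
  have "S \<subseteq> p ` {0..<l}" unfolding S_def T_def by (rule image_mono) auto
  then have "S \<subseteq> {0..<l}" by (simp only: permutes_image[OF p])
  then have lt: "x \<in> S - T \<Longrightarrow> x \<le> a" for x by (auto simp: T_def)
  have "card S = card T" unfolding S_def using inj by (rule card_image)
  then have card: "card (S - T) = card (T - S)"
    using fin by (metis card_Diff_subset_Int finite_Int inf_commute)
  have "(\<Sum>i \<in> S - T. int i) \<le> of_nat (card (S - T)) * int a"
    by (rule sum_bounded_above) (use lt in auto)
  also have "\<dots> \<le> (\<Sum>i \<in> T - S. int i)"
    unfolding card by (rule sum_bounded_below) (auto simp: T_def)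
  finally have "(\<Sum>i \<in> S - T. int i) \<le> (\<Sum>i \<in> T - S. int i)" .
  moreover have "(\<Sum>i \<in> S. int i) = (\<Sum>i \<in> S - T. int i) + (\<Sum>i \<in> S \<inter> T. int i)"
    using fin by (metis sum.Int_Diff add.commute)
  moreover have "(\<Sum>i \<in> T. int i) = (\<Sum>i \<in> T - S. int i) + (\<Sum>i \<in> S \<inter> T. int i)"
    using fin by (metis sum.Int_Diff add.commute inf_commute)
  ultimately have "(\<Sum>i \<in> S. int i) \<le> (\<Sum>i \<in> T. int i)" by linarith
  then show ?thesis unfolding S_def sum.reindex[OF inj] by (simp add: T_def comp_def)
qed

lemma g_nonzero_tail:
  assumes "gsym l \<gamma> \<noteq> 0"
  shows "0 \<le> (\<Sum>x \<in> {a..<l}. \<gamma> (x + 1))"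
proof -
  let ?A = "mat l l (\<lambda>(i, j). kh i (\<gamma> (i + 1) + int j - int i))"
  from assms have "(\<Sum>p | p permutes {0..<l}. signof p * (\<Prod>i = 0..<l. ?A $$ (i, p i))) \<noteq> 0"
    by (simp add: gsym_def det_def)
  then obtain p where p: "p permutes {0..<l}"
    and "signof p * (\<Prod>i = 0..<l. ?A $$ (i, p i)) \<noteq> 0"
    by (metis (no_types, lifting) mem_Collect_eq sum.neutral)
  then have "(\<Prod>i = 0..<l. ?A $$ (i, p i)) \<noteq> 0" by auto
  then have nz: "?A $$ (i, p i) \<noteq> 0" if "i < l" for i
    using that prod_zero[of "{0..<l}" "\<lambda>i. ?A $$ (i, p i)"] by (meson atLeastLessThan_iff
        finite_atLeastLessThan le0)
  have "0 \<le> \<gamma> (i + 1) + int (p i) - int i" if "i < l" for i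
  proof -
    have "p i < l" using permutes_in_image[OF p, of i] that by simp
    with nz[OF that] that show ?thesis by (auto simp: kh_def split: if_splits)
  qed
  then have "0 \<le> (\<Sum>i \<in> {a..<l}. \<gamma> (i + 1) + int (p i) - int i)"
    by (intro sum_nonneg) auto
  with perm_tail_sum_le[OF p, of a] show ?thesis
    by (simp add: sum.distrib sum_subtractf)
qed

lemma finite_raising_support:
  assumes "\<Psi> \<subseteq> roots l"
  shows "finite {n. (\<forall>p. p \<notin> \<Psi> \<longrightarrow> n p = 0) \<and> gsym l (raised \<Psi> n \<gamma>) \<noteq> 0}"
proof -
  have fin: "finite \<Psi>" using assms finite_roots by (rule finite_subset)
  define B where "B = (\<Sum>a \<in> {0..l}. \<bar>\<Sum>x \<in> {a..<l}. \<gamma> (x + 1)\<bar>)"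
  have bound: "int (n (i, j)) \<le> B"
    if n: "gsym l (raised \<Psi> n \<gamma>) \<noteq> 0" and ij: "(i, j) \<in> \<Psi>" for n i j
  proof -
    from ij assms have r: "1 \<le> i" "i < j" "j \<le> l" by (auto simp: roots_def)
    define a where "a = j - 1"
    have "(\<Sum>x \<in> {a..<l}. raised \<Psi> n \<gamma> (x + 1)) = (\<Sum>x \<in> {a..<l}. \<gamma> (x + 1)) +
        (\<Sum>x \<in> {a..<l}. \<Sum>q \<in> \<Psi>. int (n q) * (of_bool (x + 1 = fst q) - of_bool (x + 1 = snd q)))"
      by (simp add: raised_def sum.distrib case_prod_unfold)
    also have "(\<Sum>x \<in> {a..<l}. \<Sum>q \<in> \<Psi>. int (n q) * (of_bool (x + 1 = fst q) - of_bool (x + 1 = snd q)))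
      = (\<Sum>q \<in> \<Psi>. int (n q) * (\<Sum>x \<in> {a..<l}. of_bool (x + 1 = fst q) - of_bool (x + 1 = snd q)))"
      by (subst sum.swap) (simp add: sum_distrib_left)
    also have "\<dots> = (\<Sum>q \<in> \<Psi>. - (int (n q) * of_bool (fst q \<le> a \<and> a < snd q)))"
    proof (rule sum.cong[OF refl])
      fix q assume "q \<in> \<Psi>"
      with assms have q: "1 \<le> fst q" "fst q < snd q" "snd q \<le> l" by (auto simp: roots_def)
      have *: "(\<Sum>x \<in> {a..<l}. of_bool (x + 1 = y) :: int) = of_bool (a < y)"
        if "1 \<le> y" "y \<le> l" for y
      proof -
        have "(\<Sum>x \<in> {a..<l}. of_bool (x + 1 = y) :: int)
            = (\<Sum>x \<in> {a..<l}. if x = y - 1 then 1 else 0)"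
          using that by (intro sum.cong) auto
        with that show ?thesis by auto
      qed
      show "int (n q) * (\<Sum>x \<in> {a..<l}. of_bool (x + 1 = fst q) - of_bool (x + 1 = snd q))
          = - (int (n q) * of_bool (fst q \<le> a \<and> a < snd q))"
        unfolding sum_subtractf using q by (simp only: *) auto
    qed
    finally have "(\<Sum>x \<in> {a..<l}. raised \<Psi> n \<gamma> (x + 1)) = (\<Sum>x \<in> {a..<l}. \<gamma> (x + 1)) -
        (\<Sum>q \<in> \<Psi>. int (n q) * of_bool (fst q \<le> a \<and> a < snd q))"
      by (simp add: sum_negf)
    moreover have "0 \<le> (\<Sum>x \<in> {a..<l}. raised \<Psi> n \<gamma> (x + 1))"
      using n by (rule g_nonzero_tail)
    moreover have "i \<le> a" "a < j" using r by (auto simp: a_def)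
    then have "int (n (i, j)) \<le> (\<Sum>q \<in> \<Psi>. int (n q) * of_bool (fst q \<le> a \<and> a < snd q))"
      using member_le_sum[OF ij, of "\<lambda>q. int (n q) * of_bool (fst q \<le> a \<and> a < snd q)"] fin by simp
    moreover have "\<bar>\<Sum>x \<in> {a..<l}. \<gamma> (x + 1)\<bar> \<le> B"
      unfolding B_def by (rule member_le_sum) (use r in \<open>auto simp: a_def\<close>)
    ultimately show ?thesis by linarith
  qed
  show ?thesis
  proof (rule finite_subset)
    show "{n. (\<forall>p. p \<notin> \<Psi> \<longrightarrow> n p = 0) \<and> gsym l (raised \<Psi> n \<gamma>) \<noteq> 0}
      \<subseteq> {n. \<forall>p. (p \<in> \<Psi> \<longrightarrow> n p \<in> {..nat B}) \<and> (p \<notin> \<Psi> \<longrightarrow> n p = 0)}"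
      using bound by (force simp: le_nat_iff)
    show "finite {n. \<forall>p. (p \<in> \<Psi> \<longrightarrow> n p \<in> {..nat B}) \<and> (p \<notin> \<Psi> \<longrightarrow> n p = (0 :: nat))}"
      using fin by (intro finite_set_of_finite_funs) auto
  qed
qed

lemma g_Suc_neg:
  assumes "\<gamma> (Suc l) < 0"
  shows "gsym (Suc l) \<gamma> = 0"
  using g_nonzero_tail[of "Suc l" \<gamma> l] assms by auto

lemma kh_0: "kh r 0 = 1"
  by (simp add: kh_def) (transfer, auto)

lemma g_Suc_zero:
  assumes "\<gamma> (Suc l) = 0"
  shows "gsym (Suc l) \<gamma> = gsym l \<gamma>"
proof -
  let ?A = "mat (Suc l) (Suc l) (\<lambda>(i, j). kh i (\<gamma> (i + 1) + int j - int i))"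
  have "det ?A = (\<Sum>j<Suc l. ?A $$ (l, j) * cofactor ?A l j)"
    by (rule laplace_expansion_row) auto
  also have "\<dots> = (\<Sum>j<Suc l. if j = l then cofactor ?A l l else 0)"
    using assms by (intro sum.cong) (auto simp: kh_0, auto simp: kh_def)
  also have "\<dots> = cofactor ?A l l" by simp
  also have "\<dots> = det (mat_delete ?A l l)" by (simp add: cofactor_def flip: mult_2)
  also have "mat_delete ?A l l = mat l l (\<lambda>(i, j). kh i (\<gamma> (i + 1) + int j - int i))"
    by (rule eq_matI) (auto simp: mat_delete_def)
  finally show ?thesis by (simp add: gsym_def)
qed

lemma raising_series_pad:
  assumes \<Psi>: "\<Psi> \<subseteq> roots l" and \<Psi>': "\<Psi>' \<subseteq> roots (Suc l)" and eq: "\<Psi>' \<inter> roots l = \<Psi>"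
  shows "\<gamma> (Suc l) = 0 \<Longrightarrow> raising_series \<Psi>' (gsym (Suc l)) \<gamma> = raising_series \<Psi> (gsym l) \<gamma>"
    and "\<gamma> (Suc l) < 0 \<Longrightarrow> raising_series \<Psi>' (gsym (Suc l)) \<gamma> = 0"
proof -
  have fin: "finite \<Psi>'" "finite \<Psi>" using \<Psi> \<Psi>' finite_roots finite_subset by blast+
  have last: "raised \<Psi>' n \<gamma> (Suc l) = \<gamma> (Suc l) - (\<Sum>q \<in> \<Psi>'. int (n q) * of_bool (snd q = Suc l))"
    for n \<gamma>
  proof -
    have "(\<Sum>(i, j) \<in> \<Psi>'. int (n (i, j)) * (of_bool (Suc l = i) - of_bool (Suc l = j)))
        = (\<Sum>q \<in> \<Psi>'. - (int (n q) * of_bool (snd q = Suc l)))"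
      by (rule sum.cong) (use \<Psi>' in \<open>auto simp: roots_def\<close>)
    then show ?thesis by (simp add: raised_def sum_negf)
  qed
  have nonneg: "0 \<le> (\<Sum>q \<in> \<Psi>'. int (n q) * of_bool (snd q = Suc l))" for n
    by (rule sum_nonneg) auto
  show "raising_series \<Psi>' (gsym (Suc l)) \<gamma> = 0" if "\<gamma> (Suc l) < 0"
  proof -
    have "gsym (Suc l) (raised \<Psi>' n \<gamma>) = 0" for n
      using that nonneg[of n] by (intro g_Suc_neg) (simp add: last)
    then show ?thesis by (simp add: raising_series_def)
  qed
  assume 0: "\<gamma> (Suc l) = 0"
  have supp: "n q = 0" if "gsym (Suc l) (raised \<Psi>' n \<gamma>) \<noteq> 0" "q \<in> \<Psi>' - \<Psi>" for n q
  proof -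
    from that(2) \<Psi>' eq have "snd q = Suc l" by (auto simp: roots_def)
    then have "int (n q) \<le> (\<Sum>q \<in> \<Psi>'. int (n q) * of_bool (snd q = Suc l))"
      using member_le_sum[of q \<Psi>' "\<lambda>q. int (n q) * of_bool (snd q = Suc l)"] fin that(2) by auto
    moreover have "\<not> raised \<Psi>' n \<gamma> (Suc l) < 0" using that(1) g_Suc_neg by blast
    ultimately show ?thesis using 0 by (simp add: last)
  qed
  have same: "raised \<Psi>' n \<gamma> = raised \<Psi> n \<gamma>" if "\<forall>p. p \<notin> \<Psi> \<longrightarrow> n p = 0" for n
    unfolding raised_def fun_eq_iff using that fin eq
    by (intro allI arg_cong2[of _ _ _ _ "(+)"] refl sum.mono_neutral_right) auto
  have g_same: "gsym (Suc l) (raised \<Psi> n \<gamma>) = gsym l (raised \<Psi> n \<gamma>)" for n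
  proof (rule g_Suc_zero)
    have "(\<Sum>(i, j) \<in> \<Psi>. int (n (i, j)) * (of_bool (Suc l = i) - of_bool (Suc l = j))) = 0"
      by (rule sum.neutral) (use \<Psi> in \<open>auto simp: roots_def\<close>)
    then show "raised \<Psi> n \<gamma> (Suc l) = 0" by (simp add: raised_def 0)
  qed
  have set_eq: "{n. (\<forall>p. p \<notin> \<Psi>' \<longrightarrow> n p = 0) \<and> gsym (Suc l) (raised \<Psi>' n \<gamma>) \<noteq> 0}
      = {n. (\<forall>p. p \<notin> \<Psi> \<longrightarrow> n p = 0) \<and> gsym l (raised \<Psi> n \<gamma>) \<noteq> 0}" (is "?X = ?Y")
  proof (rule Set.set_eqI, rule iffI)
    fix n assume n: "n \<in> ?X"
    then have "\<forall>p. p \<notin> \<Psi> \<longrightarrow> n p = 0" using supp by blast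
    with n same[of n] g_same[of n] show "n \<in> ?Y" by auto
  next
    fix n assume n: "n \<in> ?Y"
    with same[of n] g_same[of n] eq show "n \<in> ?X" by auto
  qed
  show "raising_series \<Psi>' (gsym (Suc l)) \<gamma> = raising_series \<Psi> (gsym l) \<gamma>"
    unfolding raising_series_def set_eq by (rule sum.cong) (auto simp: same g_same)
qed

lemma fold_one_minus_L_pad:
  assumes "z \<notin># M"
    and "\<And>\<gamma>. \<gamma> z = 0 \<Longrightarrow> \<phi> \<gamma> = \<psi> \<gamma>" and "\<And>\<gamma>. \<gamma> z < 0 \<Longrightarrow> \<phi> \<gamma> = 0"
  shows "\<gamma> z = 0 \<Longrightarrow> fold_mset one_minus_L \<phi> (M + replicate_mset c z) \<gamma> = fold_mset one_minus_L \<psi> M \<gamma>"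
proof -
  define \<phi>' where "\<phi>' = fold_mset one_minus_L \<phi> (replicate_mset c z)"
  have "(\<forall>\<gamma>. \<gamma> z = 0 \<longrightarrow> \<phi>' \<gamma> = \<psi> \<gamma>) \<and> (\<forall>\<gamma>. \<gamma> z < 0 \<longrightarrow> \<phi>' \<gamma> = 0)"
    unfolding \<phi>'_def using assms(2,3) by (induction c) (auto simp: one_minus_L_def)
  then have "fold_mset one_minus_L \<phi>' M \<gamma> = fold_mset one_minus_L \<psi> M \<gamma>" if "\<gamma> z = 0" for \<gamma>
    using that assms(1) by (induction M arbitrary: \<gamma>) (auto simp: one_minus_L_def)
  moreover have "fold_mset one_minus_L \<phi> (M + replicate_mset c z) = fold_mset one_minus_L \<phi>' M"
    unfolding \<phi>'_def by (metis add.commute one_minus_L.fold_mset_union)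
  ultimately show "\<gamma> z = 0 \<Longrightarrow>
      fold_mset one_minus_L \<phi> (M + replicate_mset c z) \<gamma> = fold_mset one_minus_L \<psi> M \<gamma>"
    by simp
qed

lemma part_snoc_0: "part (mu @ [0]) = part mu"
  by (auto simp: part_def fun_eq_iff nth_append)

lemma Delta_snoc_0: "Delta k (mu @ [0]) \<inter> roots (length mu) = Delta k mu"
  by (auto simp: Delta_def roots_def part_snoc_0)

lemma L_Delta_snoc_0:
  "\<exists>c. Lset (Delta k (mu @ [0])) = Lset (Delta k mu) + replicate_mset c (Suc (length mu))"
proof -
  define D where "D = Delta k (mu @ [0]) - Delta k mu"
  have D: "finite D" "\<And>q. q \<in> D \<Longrightarrow> snd q = Suc (length mu)"
    using finite_Delta[of k "mu @ [0]"] by (simp add: D_def)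
      (auto simp: D_def Delta_def roots_def part_snoc_0)
  have "Delta k (mu @ [0]) = Delta k mu \<union> D" "Delta k mu \<inter> D = {}"
    using Delta_snoc_0[of k mu] by (auto simp: D_def)
  then have "Lset (Delta k (mu @ [0])) = Lset (Delta k mu) + Lset D"
    using D(1) finite_Delta by (simp add: Lset_def mset_set_Union)
  also have "Lset D = image_mset (\<lambda>_. Suc (length mu)) (mset_set D)"
    unfolding Lset_def by (rule image_mset_cong) (use D in auto)
  finally show ?thesis by (auto simp: image_mset_const_eq)
qed

lemma K_k_Schur_snoc_0: "K_k_Schur k (mu @ [0]) = K_k_Schur k mu"
proof -
  obtain c where c: "Lset (Delta (k + 1) (mu @ [0]))
      = Lset (Delta (k + 1) mu) + replicate_mset c (Suc (length mu))"
    using L_Delta_snoc_0 by blast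
  have "Suc (length mu) \<notin># Lset (Delta (k + 1) mu)"
    using finite_Delta[of "k + 1" mu] by (auto simp: Lset_def Delta_def roots_def)
  moreover note raising_series_pad[OF Delta_subset_roots[of k mu] _ Delta_snoc_0[of k mu]]
  moreover have "Delta k (mu @ [0]) \<subseteq> roots (Suc (length mu))"
    using Delta_subset_roots[of k "mu @ [0]"] by simp
  ultimately show ?thesis
    unfolding K_k_Schur_def katalan_def c part_snoc_0 length_append_singleton
    by (intro fold_one_minus_L_pad) (auto simp: part_def)
qed

lemma K_k_Schur_pad: "K_k_Schur k (mu @ replicate m 0) = K_k_Schur k mu"
proof (induction m)
  case (Suc m)
  have "mu @ replicate (Suc m) 0 = (mu @ replicate m 0) @ [0]"
    by (simp add: replicate_append_same)
  then show ?case using K_k_Schur_snoc_0 Suc by metis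
qed simp

end

theory Submission
  imports Defs
begin

text \<open>
  Let \<open>z\<^sub>x\<close> be the first column of row \<open>x\<close> of \<open>\<Delta>\<^sup>k(\<lambda>)\<close>. The closed k-Schur Katalan function arises from the
  K-k-Schur function of \<open>\<lambda>\<close> by applying \<open>1 - L\<^bsub>z\<^sub>x\<^esub>\<close> for every nonempty row \<open>x\<close>. Removing the first root
  of row \<open>z = z\<^sub>x\<close> turns the operator of row \<open>x\<close> into the operator of row \<open>z\<close>, applied to the function
  of \<open>\<lambda>\<close> minus the function of \<open>\<lambda> - \<epsilon>\<^sub>z\<close>; when \<open>\<lambda>\<^sub>z = \<lambda>\<^sub>z\<^sub>+\<^sub>1\<close> the second term vanishes by a straightening
  argument along the bounce path \<open>x, z\<^sub>x, \<dots>\<close>, which needs the strict decrease of \<open>\<lambda>\<close> at its start.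
  Each operator thus moves down its bounce path until it leaves the diagram, and every size drop by one
  comes with one sign.
\<close>

section \<open>Root expansions and straightening of Katalan functions\<close>

text \<open>The generating function of \<open>kh r\<close> is that of \<open>hsym\<close> divided by
  \<open>(1 - t)^r\<close>, so taking the difference is multiplication by \<open>1 - t\<close>; on
  coefficients this is Pascal's rule.\<close>

lemma kh_Suc_diff: "kh (Suc r) m - kh (Suc r) (m - 1) = kh r m"
proof (cases "m \<le> 0")
  case True
  then show ?thesis by (cases "m = 0") (simp_all add: kh_0, simp_all add: kh_def)
next
  case False
  define n where "n = nat (m - 1)"
  have m: "nat m = Suc n" "\<not> m < 0" "nat (m - 1) = n" "\<not> m - 1 < 0"
    using False by (auto simp: n_def)
  have "kh (Suc r) m = hsym (Suc n) + (\<Sum>i\<le>n. of_nat ((r + Suc i) choose Suc i) * hsym (n - i))"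
    unfolding kh_def m using m(2) by (simp add: atLeast0AtMost sum.atMost_Suc_shift del: sum.atMost_Suc)
  moreover have "kh (Suc r) (m - 1) = (\<Sum>i\<le>n. of_nat ((r + i) choose i) * hsym (n - i))"
    unfolding kh_def m using m(4) by (simp add: atLeast0AtMost)
  moreover have "kh r m = hsym (Suc n) + (\<Sum>i\<le>n. of_nat ((r + i) choose Suc i) * hsym (n - i))"
    unfolding kh_def m using m(2) by (simp add: atLeast0AtMost sum.atMost_Suc_shift del: sum.atMost_Suc)
  ultimately show ?thesis
    by (simp add: sum.distrib algebra_simps)
qed

lemma det_row_diff:
  fixes A B C :: "'a :: comm_ring_1 mat"
  assumes A: "A \<in> carrier_mat n n" and B: "B \<in> carrier_mat n n" and C: "C \<in> carrier_mat n n"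
    and r: "r < n" and "\<And>j. j < n \<Longrightarrow> C $$ (r, j) = A $$ (r, j) - B $$ (r, j)"
    and "\<And>i j. i < n \<Longrightarrow> j < n \<Longrightarrow> i \<noteq> r \<Longrightarrow> A $$ (i, j) = C $$ (i, j)"
    and "\<And>i j. i < n \<Longrightarrow> j < n \<Longrightarrow> i \<noteq> r \<Longrightarrow> B $$ (i, j) = C $$ (i, j)"
  shows "det A - det B = det C"
proof -
  have "mat_delete A r j = mat_delete C r j" "mat_delete B r j = mat_delete C r j" if "j < n" for j
    using A B C assms(6,7) r that by (auto simp: mat_delete_def intro!: eq_matI)
  then have "cofactor A r j = cofactor C r j" "cofactor B r j = cofactor C r j" if "j < n" for j
    using that by (simp_all add: cofactor_def)
  then show ?thesis
    using assms(5) by (simp add: laplace_expansion_row[OF A r] laplace_expansion_row[OF B r]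
        laplace_expansion_row[OF C r] left_diff_distrib flip: sum_subtractf)
qed

abbreviation swap :: "nat \<Rightarrow> nat \<Rightarrow> nat" where
  "swap y \<equiv> Transposition.transpose y (Suc y)"

text \<open>The dot action \<open>s(\<gamma> + \<rho>) - \<rho>\<close> of the adjacent
  transposition, with \<rho> decreasing by 1 from each position to the next.\<close>

definition dot_swap :: "nat \<Rightarrow> (nat \<Rightarrow> int) \<Rightarrow> nat \<Rightarrow> int" where
  "dot_swap y \<gamma> = \<gamma>(y := \<gamma> (Suc y) - 1, Suc y := \<gamma> y + 1)"

definition antisymmetric :: "nat \<Rightarrow> ((nat \<Rightarrow> int) \<Rightarrow> symfun) \<Rightarrow> bool" where
  "antisymmetric y \<phi> \<longleftrightarrow> (\<forall>\<gamma>. \<phi> (dot_swap y \<gamma>) = - \<phi> \<gamma>)"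

text \<open>
  Applying \<open>1 - L\<^sub>y\<^sub>+\<^sub>1\<close> lowers the superscript in row \<open>y + 1\<close> of the determinant to that of row \<open>y\<close>,
  after which the dot action of the transposition exchanges the two rows.
\<close>

lemma antisymmetric_gsym:
  assumes y: "1 \<le> y" "y < l"
  shows "antisymmetric y (one_minus_L (Suc y) (gsym l))"
proof -
  \<comment> \<open>Position \<open>y + 1\<close> is matrix row \<open>y\<close>, counted from 0; in
    \<open>D\<close> it carries the superscript \<open>y - 1\<close> of the row before it.\<close>
  define D where "D \<gamma> = mat l l (\<lambda>(i, j). kh (if i = y then y - 1 else i) (\<gamma> (i + 1) + int j - int i))"
    for \<gamma>
  have D: "one_minus_L (Suc y) (gsym l) \<gamma> = det (D \<gamma>)" for \<gamma>
  proof -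
    have "kh y m - kh y (m - 1) = kh (y - 1) m" for m
      using kh_Suc_diff[of "y - 1" m] y by simp
    from this[of "\<gamma> (Suc y) + int _ - int y"] show ?thesis
      unfolding one_minus_L_def gsym_def D_def
      by (intro det_row_diff[where r = y and n = l]) (use y in \<open>auto simp: algebra_simps\<close>)
  qed
  have "det (D (dot_swap y \<gamma>)) = - det (D \<gamma>)" for \<gamma>
  proof -
    have "D (dot_swap y \<gamma>) = swaprows (y - 1) y (D \<gamma>)"
      by (rule eq_matI) (use y in \<open>auto simp: D_def dot_swap_def algebra_simps of_nat_diff\<close>)
    then show ?thesis
      using det_swaprows[of "y - 1" l y "D \<gamma>"] y by (simp add: D_def)
  qed
  then show ?thesis by (simp add: antisymmetric_def D)
qed

section \<open>Raising series: removing a root, and antisymmetry\<close>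

definition raise :: "nat \<times> nat \<Rightarrow> (nat \<Rightarrow> int) \<Rightarrow> nat \<Rightarrow> int" where
  "raise \<beta> \<gamma> x = \<gamma> x + of_bool (x = fst \<beta>) - of_bool (x = snd \<beta>)"

definition expos :: "(nat \<times> nat) set \<Rightarrow> (nat \<times> nat \<Rightarrow> nat) set" where
  "expos \<Psi> = {n. \<forall>p. p \<notin> \<Psi> \<longrightarrow> n p = 0}"

definition raising_support ::
  "nat \<Rightarrow> (nat \<times> nat) set \<Rightarrow> (nat \<Rightarrow> int) \<Rightarrow> (nat \<times> nat \<Rightarrow> nat) set" where
  "raising_support l \<Psi> \<gamma> = {n \<in> expos \<Psi>. gsym l (raised \<Psi> n \<gamma>) \<noteq> 0}"

lemma finite_support: "\<Psi> \<subseteq> roots l \<Longrightarrow> finite (raising_support l \<Psi> \<gamma>)"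
  using finite_raising_support[of \<Psi> l \<gamma>] by (simp add: raising_support_def expos_def)

text \<open>Terms outside the support vanish, so series at different weights, whose supports differ,
  can be compared over one finite index set.\<close>

lemma raising_series_eq_sum:
  assumes "finite N" "N \<subseteq> expos \<Psi>" "raising_support l \<Psi> \<gamma> \<subseteq> N"
  shows "raising_series \<Psi> (gsym l) \<gamma> = (\<Sum>n\<in>N. gsym l (raised \<Psi> n \<gamma>))"
proof -
  have "raising_series \<Psi> (gsym l) \<gamma> = (\<Sum>n\<in>raising_support l \<Psi> \<gamma>. gsym l (raised \<Psi> n \<gamma>))"
    by (simp add: raising_series_def raising_support_def expos_def)
  also have "\<dots> = (\<Sum>n\<in>N. gsym l (raised \<Psi> n \<gamma>))"
    by (rule sum.mono_neutral_left) (use assms in \<open>auto simp: raising_support_def\<close>)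
  finally show ?thesis .
qed

lemma raised_zero_at:
  assumes "finite \<Psi>" "n \<beta> = 0"
  shows "raised \<Psi> n \<gamma> = raised (\<Psi> - {\<beta>}) n \<gamma>"
  unfolding raised_def fun_eq_iff using assms
  by (intro allI arg_cong2[of _ _ _ _ "(+)"] refl sum.mono_neutral_right) auto

lemma raised_Suc_at:
  assumes "finite \<Psi>" "\<beta> \<in> \<Psi>"
  shows "raised \<Psi> (n(\<beta> := Suc (n \<beta>))) \<gamma> = raised \<Psi> n (raise \<beta> \<gamma>)"
proof
  fix x
  let ?f = "\<lambda>n :: nat \<times> nat \<Rightarrow> nat. \<lambda>q :: nat \<times> nat. int (n q) * (of_bool (x = fst q) - of_bool (x = snd q))"
  have rem: "sum (?f m) \<Psi> = ?f m \<beta> + sum (?f m) (\<Psi> - {\<beta>})" for m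
    by (rule sum.remove) (use assms in auto)
  have "sum (?f (n(\<beta> := Suc (n \<beta>)))) (\<Psi> - {\<beta>}) = sum (?f n) (\<Psi> - {\<beta>})"
    by (rule sum.cong) auto
  then have "sum (?f (n(\<beta> := Suc (n \<beta>)))) \<Psi> =
      sum (?f n) \<Psi> + (of_bool (x = fst \<beta>) - of_bool (x = snd \<beta>))"
    unfolding rem by (simp add: distrib_right)
  then show "raised \<Psi> (n(\<beta> := Suc (n \<beta>))) \<gamma> x = raised \<Psi> n (raise \<beta> \<gamma>) x"
    unfolding raised_def raise_def case_prod_unfold prod.collapse by linarith
qed

text \<open>Geometric series: (1 - R)^-1 = 1 + R (1 - R)^-1 for the raising operator R of \<beta>.
  Exponent vectors split by whether the exponent of \<beta> is zero (\<open>N0\<close>) or positive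
  (the image of \<open>N1\<close> under \<open>up\<close>).\<close>

lemma raising_series_remove:
  assumes \<Psi>: "\<Psi> \<subseteq> roots l" and \<beta>: "\<beta> \<in> \<Psi>"
  shows "raising_series \<Psi> (gsym l) \<gamma> =
    raising_series (\<Psi> - {\<beta>}) (gsym l) \<gamma> + raising_series \<Psi> (gsym l) (raise \<beta> \<gamma>)"
proof -
  have fin: "finite \<Psi>" using \<Psi> finite_roots finite_subset by blast
  define up where "up = (\<lambda>n :: nat \<times> nat \<Rightarrow> nat. n(\<beta> := Suc (n \<beta>)))"
  define N0 where "N0 = raising_support l (\<Psi> - {\<beta>}) \<gamma>"
  define N1 where "N1 = raising_support l \<Psi> (raise \<beta> \<gamma>)"
  have fins: "finite N0" "finite N1" unfolding N0_def N1_def using \<Psi> by (auto intro: finite_support)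
  have inj: "inj_on up N1"
  proof (rule inj_onI)
    fix m n :: "nat \<times> nat \<Rightarrow> nat" assume *: "up m = up n"
    have "m q = n q" for q using fun_cong[OF *, of q] by (auto simp: up_def split: if_splits)
    then show "m = n" by auto
  qed
  have sub: "N0 \<subseteq> expos \<Psi>" "up ` N1 \<subseteq> expos \<Psi>"
    using \<beta> by (auto simp: N0_def N1_def raising_support_def expos_def up_def)
  have zero: "n \<beta> = 0" if "n \<in> N0" for n
    using that unfolding N0_def raising_support_def expos_def by blast
  have disj: "N0 \<inter> up ` N1 = {}"
  proof -
    have "up n \<beta> \<noteq> 0" for n by (simp add: up_def)
    then show ?thesis using zero by blast
  qed
  have "raising_support l \<Psi> \<gamma> \<subseteq> N0 \<union> up ` N1"
  proof
    fix n assume n: "n \<in> raising_support l \<Psi> \<gamma>"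
    show "n \<in> N0 \<union> up ` N1"
    proof (cases "n \<beta>")
      case 0
      then have "n \<in> N0"
        using n raised_zero_at[OF fin, of n \<beta>] by (auto simp: N0_def raising_support_def expos_def)
      then show ?thesis ..
    next
      case (Suc k)
      then have up: "n = up (n(\<beta> := k))" by (auto simp: up_def)
      then have "raised \<Psi> n \<gamma> = raised \<Psi> (n(\<beta> := k)) (raise \<beta> \<gamma>)"
        using raised_Suc_at[OF fin \<beta>, of "n(\<beta> := k)"] by (metis up_def)
      then have "n(\<beta> := k) \<in> N1" using n \<beta> by (auto simp: N1_def raising_support_def expos_def)
      then show ?thesis using up by blast
    qed
  qed
  then have "raising_series \<Psi> (gsym l) \<gamma> = (\<Sum>n\<in>N0 \<union> up ` N1. gsym l (raised \<Psi> n \<gamma>))"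
    using sub fins by (intro raising_series_eq_sum) auto
  also have "\<dots> = (\<Sum>n\<in>N0. gsym l (raised \<Psi> n \<gamma>)) + (\<Sum>n\<in>up ` N1. gsym l (raised \<Psi> n \<gamma>))"
    using fins disj by (intro sum.union_disjoint) auto
  also have "(\<Sum>n\<in>N0. gsym l (raised \<Psi> n \<gamma>)) = raising_series (\<Psi> - {\<beta>}) (gsym l) \<gamma>"
  proof -
    have "(\<Sum>n\<in>N0. gsym l (raised \<Psi> n \<gamma>)) = (\<Sum>n\<in>N0. gsym l (raised (\<Psi> - {\<beta>}) n \<gamma>))"
      by (rule sum.cong[OF refl]) (simp add: raised_zero_at[of _ _ \<beta>, OF fin] zero)
    then show ?thesis
      using fins by (subst raising_series_eq_sum[of N0]) (auto simp: N0_def raising_support_def)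
  qed
  also have "(\<Sum>n\<in>up ` N1. gsym l (raised \<Psi> n \<gamma>)) = raising_series \<Psi> (gsym l) (raise \<beta> \<gamma>)"
  proof -
    have "raised \<Psi> (up n) \<gamma> = raised \<Psi> n (raise \<beta> \<gamma>)" for n
      unfolding up_def by (rule raised_Suc_at[OF fin \<beta>])
    then have "(\<Sum>n\<in>up ` N1. gsym l (raised \<Psi> n \<gamma>)) = (\<Sum>n\<in>N1. gsym l (raised \<Psi> n (raise \<beta> \<gamma>)))"
      by (simp add: sum.reindex[OF inj])
    then show ?thesis
      using fins by (subst raising_series_eq_sum[of N1]) (auto simp: N1_def raising_support_def)
  qed
  finally show ?thesis .
qed

definition root_swap :: "nat \<Rightarrow> nat \<times> nat \<Rightarrow> nat \<times> nat" where
  "root_swap y = map_prod (swap y) (swap y)"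

lemma root_swap_invol [simp]: "root_swap y (root_swap y p) = p"
  by (cases p) (simp add: root_swap_def)

definition swap_invariant :: "nat \<Rightarrow> (nat \<times> nat) set \<Rightarrow> bool" where
  "swap_invariant y \<Psi> \<longleftrightarrow> (\<forall>p\<in>\<Psi>. root_swap y p \<in> \<Psi>)"

text \<open>The dot action is affine with the transposition as linear part, so it turns a shift by a
  root into a shift by the swapped root; invariance of \<Psi> makes this a relabelling of
  exponents.\<close>

lemma raised_dot_swap:
  assumes inv: "swap_invariant y \<Psi>"
  shows "raised \<Psi> n (dot_swap y \<gamma>) = dot_swap y (raised \<Psi> (n \<circ> root_swap y) \<gamma>)"
proof
  fix x
  have swap: "(\<Sum>q\<in>\<Psi>. int (n q) * (of_bool (x = fst q) - of_bool (x = snd q)))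
     = (\<Sum>q\<in>\<Psi>. int ((n \<circ> root_swap y) q) * (of_bool (swap y x = fst q) - of_bool (swap y x = snd q)))" for x
  proof -
    have "(swap y a = swap y b) = (a = b)" for a b by (metis transpose_involutory)
    moreover have "fst (root_swap y q) = swap y (fst q)" "snd (root_swap y q) = swap y (snd q)" for q
      by (simp_all add: root_swap_def)
    moreover have "root_swap y q \<in> \<Psi>" if "q \<in> \<Psi>" for q
      using inv that by (simp add: swap_invariant_def)
    ultimately show ?thesis
      by (intro sum.reindex_bij_witness[of _ "root_swap y" "root_swap y"]) simp_all
  qed
  show "raised \<Psi> n (dot_swap y \<gamma>) x = dot_swap y (raised \<Psi> (n \<circ> root_swap y) \<gamma>) x"
    unfolding raised_def case_prod_unfold prod.collapse
    by (subst swap) (auto simp: dot_swap_def transpose_def)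
qed

text \<open>Relabelling exponents permutes the terms of the series, so the sign that each
  determinant picks up passes to the sum.\<close>

lemma antisymmetric_raising_series:
  assumes \<Psi>: "\<Psi> \<subseteq> roots l" and inv: "swap_invariant y \<Psi>" and y: "1 \<le> y" "y < l"
  shows "antisymmetric y (one_minus_L (Suc y) (raising_series \<Psi> (gsym l)))"
  unfolding antisymmetric_def
proof
  fix \<gamma>
  let ?g = "one_minus_L (Suc y) (gsym l)"
  define low where "low \<gamma> = \<gamma>(Suc y := \<gamma> (Suc y) - 1)" for \<gamma> :: "nat \<Rightarrow> int"
  \<comment> \<open>Both sides are differences of series at two weights. To sum them over one index
    set, all four supports are joined and then closed under relabelling.\<close>
  define N0 where "N0 = raising_support l \<Psi> \<gamma> \<union> raising_support l \<Psi> (low \<gamma>) \<union>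
    raising_support l \<Psi> (dot_swap y \<gamma>) \<union> raising_support l \<Psi> (low (dot_swap y \<gamma>))"
  define N where "N = N0 \<union> (\<lambda>n. n \<circ> root_swap y) ` N0"
  have "finite N0" using \<Psi> by (simp add: N0_def finite_support)
  then have N: "finite N" by (simp add: N_def)
  have "N0 \<subseteq> expos \<Psi>" by (auto simp: N0_def raising_support_def)
  moreover have "n \<circ> root_swap y \<in> expos \<Psi>" if "n \<in> expos \<Psi>" for n
  proof -
    have "root_swap y p \<notin> \<Psi>" if "p \<notin> \<Psi>" for p
      using inv that root_swap_invol[of y p] unfolding swap_invariant_def by metis
    with that show ?thesis unfolding expos_def mem_Collect_eq comp_apply by blast
  qed
  ultimately have sub: "N \<subseteq> expos \<Psi>" by (auto simp: N_def)
  have invol: "n \<circ> root_swap y \<circ> root_swap y = n" for n :: "nat \<times> nat \<Rightarrow> nat" by (simp add: comp_def)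
  have raised_low: "raised \<Psi> n (low \<delta>) = low (raised \<Psi> n \<delta>)" for n \<delta>
    by (rule ext) (simp add: raised_def low_def)
  have expand: "one_minus_L (Suc y) (raising_series \<Psi> (gsym l)) \<delta> = (\<Sum>n\<in>N. ?g (raised \<Psi> n \<delta>))"
    if "raising_support l \<Psi> \<delta> \<subseteq> N" "raising_support l \<Psi> (low \<delta>) \<subseteq> N" for \<delta>
    unfolding one_minus_L_def low_def[symmetric] using N sub that
    by (simp add: raising_series_eq_sum[of N] raised_low sum_subtractf)
  have "one_minus_L (Suc y) (raising_series \<Psi> (gsym l)) (dot_swap y \<gamma>) = (\<Sum>n\<in>N. ?g (raised \<Psi> n (dot_swap y \<gamma>)))"
    by (rule expand) (auto simp: N_def N0_def)
  also have "\<dots> = (\<Sum>n\<in>N. - ?g (raised \<Psi> (n \<circ> root_swap y) \<gamma>))"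
    using antisymmetric_gsym[OF y] by (simp add: raised_dot_swap[OF inv] antisymmetric_def)
  also have "\<dots> = (\<Sum>n\<in>N. - ?g (raised \<Psi> n \<gamma>))"
    by (rule sum.reindex_bij_witness[of _ "\<lambda>n. n \<circ> root_swap y" "\<lambda>n. n \<circ> root_swap y"])
      (auto simp: invol N_def image_iff)
  also have "\<dots> = - one_minus_L (Suc y) (raising_series \<Psi> (gsym l)) \<gamma>"
    by (subst expand) (auto simp: N_def N0_def sum_negf)
  finally show "one_minus_L (Suc y) (raising_series \<Psi> (gsym l)) (dot_swap y \<gamma>) = - one_minus_L (Suc y) (raising_series \<Psi> (gsym l)) \<gamma>" .
qed

section \<open>Katalan functions: root removal and straightening\<close>

text \<open>Lowering index \<open>z\<close> after the dot action is lowering index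
  \<open>swap y z\<close> before it, so the operators pass through with \<open>y\<close> and
  \<open>y + 1\<close> exchanged.\<close>

lemma fold_one_minus_L_dot_swap:
  assumes "antisymmetric y \<phi>"
  shows "fold_mset one_minus_L \<phi> M (dot_swap y \<gamma>) = - fold_mset one_minus_L \<phi> (image_mset (swap y) M) \<gamma>"
proof (induction M arbitrary: \<gamma>)
  case empty
  then show ?case using assms by (simp add: antisymmetric_def)
next
  case (add z M)
  have "(dot_swap y \<gamma>)(z := dot_swap y \<gamma> z - 1) = dot_swap y (\<gamma>(swap y z := \<gamma> (swap y z) - 1))"
    by (auto simp: dot_swap_def fun_eq_iff transpose_def)
  then show ?case
    unfolding image_mset_add_mset one_minus_L.fold_mset_add_mset one_minus_L_def[of _ "fold_mset _ _ _"]
    using add.IH by (metis minus_diff_minus)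
qed

lemma symfun_eq_uminus_self:
  fixes f :: symfun
  assumes "f = - f"
  shows "f = 0"
proof (rule symfun_eqI)
  fix M
  have "sf_coeff f M = - sf_coeff f M" using assms by (metis uminus_symfun.rep_eq)
  then show "sf_coeff f M = sf_coeff 0 M" by (simp add: zero_symfun.rep_eq)
qed

lemma katalan_add_mset: "katalan l \<Psi> (add_mset z M) \<gamma> = katalan l \<Psi> M \<gamma> - katalan l \<Psi> M (\<gamma>(z := \<gamma> z - 1))"
  by (simp add: katalan_def one_minus_L_def)

text \<open>Index shifts commute, so the geometric series identity survives every lowering
  operator.\<close>

lemma katalan_remove:
  assumes \<Psi>: "\<Psi> \<subseteq> roots l" and \<beta>: "\<beta> \<in> \<Psi>"
  shows "katalan l \<Psi> M \<gamma> = katalan l (\<Psi> - {\<beta>}) M \<gamma> + katalan l \<Psi> M (raise \<beta> \<gamma>)"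
proof (induction M arbitrary: \<gamma>)
  case empty
  show ?case unfolding katalan_def fold_mset_empty by (rule raising_series_remove[OF assms])
next
  case (add z M)
  define \<gamma>' where "\<gamma>' = \<gamma>(z := \<gamma> z - 1)"
  have "(raise \<beta> \<gamma>)(z := raise \<beta> \<gamma> z - 1) = raise \<beta> \<gamma>'"
    by (rule ext) (simp add: raise_def \<gamma>'_def)
  then show ?case
    unfolding katalan_add_mset using add.IH[of \<gamma>] add.IH[of \<gamma>'] by (simp add: \<gamma>'_def[symmetric])
qed

text \<open>One copy of \<open>Suc y\<close> in \<open>M\<close> makes the raising series
  antisymmetric, the count makes the remaining operators symmetric in \<open>y\<close> and
  \<open>y + 1\<close>, and \<gamma> is fixed by the dot action. So the value is its own
  negative.\<close>

lemma katalan_dot_swap_fixed: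
  assumes "\<Psi> \<subseteq> roots l" "swap_invariant y \<Psi>" "1 \<le> y" "y < l"
    and count: "count M (Suc y) = Suc (count M y)" and \<gamma>: "\<gamma> y = \<gamma> (Suc y) - 1"
  shows "katalan l \<Psi> M \<gamma> = 0"
proof (rule symfun_eq_uminus_self)
  let ?\<phi> = "one_minus_L (Suc y) (raising_series \<Psi> (gsym l))"
  obtain N where N: "M = add_mset (Suc y) N"
    using count by (metis Suc_neq_Zero count_eq_zero_iff insert_DiffM zero_less_Suc)
  have "image_mset (swap y) N = N"
  proof (rule multiset_eqI)
    fix x
    have "swap y -` {x} = {swap y x}" by (auto simp: transpose_eq_iff) 
    then have "count (image_mset (swap y) N) x = count N (swap y x)"
      by (simp add: count_image_mset Int_insert_left not_in_iff)
    then show "count (image_mset (swap y) N) x = count N x"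
      using count by (auto simp: N transpose_def)
  qed
  moreover have "dot_swap y \<gamma> = \<gamma>" using \<gamma> by (auto simp: dot_swap_def)
  moreover have "katalan l \<Psi> M = fold_mset one_minus_L ?\<phi> N"
    by (simp add: N katalan_def fun_eq_iff one_minus_L.fold_mset_fun_left_comm)
  ultimately show "katalan l \<Psi> M \<gamma> = - katalan l \<Psi> M \<gamma>"
    using fold_one_minus_L_dot_swap[OF antisymmetric_raising_series[OF assms(1-4)], of N \<gamma>] by simp
qed

section \<open>Vanishing: negative tail sums and mirrors\<close>

text \<open>A raising operator moves weight to an earlier position, so it may take weight out of a
  tail but never into it.\<close>

lemma raised_tail_le:
  assumes "\<Psi> \<subseteq> roots l"
  shows "(\<Sum>x\<in>{a..<l}. raised \<Psi> n \<gamma> (x + 1)) \<le> (\<Sum>x\<in>{a..<l}. \<gamma> (x + 1))"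
proof -
  have *: "(\<Sum>x\<in>{a..<l}. of_bool (x + 1 = fst q) - of_bool (x + 1 = snd q)) \<le> (0 :: int)"
    if "q \<in> \<Psi>" for q
  proof -
    have q: "1 \<le> fst q" "fst q < snd q" "snd q \<le> l" using that assms by (auto simp: roots_def)
    have "(\<Sum>x\<in>{a..<l}. of_bool (x + 1 = y)) = (of_bool (a < y \<and> y \<le> l) :: int)" if "1 \<le> y" for y
    proof -
      have "(\<Sum>x\<in>{a..<l}. of_bool (x + 1 = y)) = (\<Sum>x\<in>{a..<l}. if x = y - 1 then 1 else (0 :: int))"
        using that by (intro sum.cong) auto
      then show ?thesis using that by auto
    qed
    from this[of "fst q"] this[of "snd q"] show ?thesis using q by (simp add: sum_subtractf)
  qed
  have "(\<Sum>x\<in>{a..<l}. raised \<Psi> n \<gamma> (x + 1)) = (\<Sum>x\<in>{a..<l}. \<gamma> (x + 1)) +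
     (\<Sum>q\<in>\<Psi>. int (n q) * (\<Sum>x\<in>{a..<l}. of_bool (x + 1 = fst q) - of_bool (x + 1 = snd q)))"
    by (simp add: raised_def sum.distrib case_prod_unfold sum_distrib_left sum.swap[of _ \<Psi>])
  moreover have "(\<Sum>q\<in>\<Psi>. int (n q) * (\<Sum>x\<in>{a..<l}. of_bool (x + 1 = fst q) - of_bool (x + 1 = snd q))) \<le> 0"
    by (intro sum_nonpos mult_nonneg_nonpos *) auto
  ultimately show ?thesis by linarith
qed

text \<open>Neither raising nor lowering increases a tail sum, and a determinant with a negative
  tail sum is zero. The contrapositive serves as a vanishing criterion.\<close>

lemma katalan_nonzero_tail:
  assumes \<Psi>: "\<Psi> \<subseteq> roots l" and "katalan l \<Psi> M \<gamma> \<noteq> 0"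
  shows "0 \<le> (\<Sum>x\<in>{a..<l}. \<gamma> (x + 1))"
  using assms(2)
proof (induction M arbitrary: \<gamma>)
  case empty
  then obtain n where "gsym l (raised \<Psi> n \<gamma>) \<noteq> 0"
    by (fastforce simp: katalan_def raising_series_def)
  from g_nonzero_tail[OF this, of a] raised_tail_le[OF \<Psi>, of n \<gamma> a] show ?case by linarith
next
  case (add z M)
  have "(\<Sum>x\<in>{a..<l}. (\<gamma>(z := \<gamma> z - 1)) (x + 1)) \<le> (\<Sum>x\<in>{a..<l}. \<gamma> (x + 1))"
    by (rule sum_mono) auto
  moreover from add.prems have "katalan l \<Psi> M \<gamma> \<noteq> 0 \<or> katalan l \<Psi> M (\<gamma>(z := \<gamma> z - 1)) \<noteq> 0"
    by (auto simp: katalan_add_mset)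
  ultimately show ?case using add.IH by (meson order_trans)
qed

text \<open>The condition is followed backwards along a bounce path: symmetry in \<open>y\<close>,
  \<open>y + 1\<close> is broken only by \<open>(Suc x, Suc y)\<close>, and without
  \<open>(x, y)\<close> a mirror ends at \<open>x\<close>. \<open>X\<close> collects the earlier
  positions \<open>x\<close>, at which the weight will have to agree with its value at
  \<open>x + 1\<close>.\<close>

inductive mirror :: "(nat \<times> nat) set \<Rightarrow> nat \<Rightarrow> nat set \<Rightarrow> bool" where
  mirror_base: "swap_invariant y \<Phi> \<Longrightarrow> mirror \<Phi> y {}"
| mirror_step: "mirror (\<Phi> - {(x, y)}) x X \<Longrightarrow> Suc x < y \<Longrightarrow> (x, y) \<in> \<Phi> \<Longrightarrow> (Suc x, Suc y) \<in> \<Phi> \<Longrightarrow>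
    swap_invariant y (\<Phi> - {(Suc x, Suc y)}) \<Longrightarrow> mirror \<Phi> y (insert x X)"

lemma mirror_less: "mirror \<Phi> y X \<Longrightarrow> x \<in> X \<Longrightarrow> Suc x < y"
  by (induction rule: mirror.induct) auto

text \<open>
  Removing the two roots \<open>(x + 1, y + 1)\<close> and \<open>(x, y)\<close> in turn leaves only
  terms that vanish by antisymmetry in \<open>y, y + 1\<close> or, inductively, by the shorter mirror ending in
  \<open>x\<close>, and one term of the original shape whose weight is moved from rows \<open>y, y + 1\<close> to rows
  \<open>x, x + 1\<close>. This cannot go on forever, since the tail sums of the weight decrease.
\<close>

lemma katalan_mirror:
  assumes "mirror \<Phi> y X" "\<Phi> \<subseteq> roots l"
    and "\<And>x. x \<in> insert y X \<Longrightarrow> 1 \<le> x \<and> x < l \<and> count M (Suc x) = Suc (count M x)"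
    and "\<gamma> y = \<gamma> (Suc y) - 1" and "\<And>x. x \<in> X \<Longrightarrow> \<gamma> x = \<gamma> (Suc x)"
  shows "katalan l \<Phi> M \<gamma> = 0"
  using assms
proof (induction \<Phi> y X arbitrary: \<gamma> rule: mirror.induct)
  case (mirror_base y \<Phi>)
  then show ?case by (intro katalan_dot_swap_fixed[of _ _ y]) auto
next
  case (mirror_step \<Phi> x y X)
  have less: "Suc t < x" if "t \<in> X" for t
    using mirror_less[OF mirror_step.hyps(1) that] .
  note xy = mirror_step.hyps(2)
  \<comment> \<open>Tail sum over the positions \<open>y\<close> to \<open>l\<close>, for the inner
    induction. The \<open>+ 1\<close> in the measure lets it drop even from tail sum 0 to a negative
    one.\<close>
  let ?tail = "\<lambda>\<gamma> :: nat \<Rightarrow> int. \<Sum>t\<in>{y - 1..<l}. \<gamma> (t + 1)"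
  show ?case
    using mirror_step.prems(3,4)
  proof (induction "nat (?tail \<gamma> + 1)" arbitrary: \<gamma> rule: less_induct)
    case (less \<gamma>)
    show ?case
    proof (cases "?tail \<gamma> < 0")
      case True
      then show ?thesis using katalan_nonzero_tail[OF mirror_step.prems(1)] by (meson not_le)
    next
      case False
      define \<gamma>1 where "\<gamma>1 = raise (Suc x, Suc y) \<gamma>"
      define \<gamma>2 where "\<gamma>2 = raise (x, y) \<gamma>1"
      have y: "1 \<le> y" "y < l" "count M (Suc y) = Suc (count M y)"
        using mirror_step.prems(2)[of y] by auto
      have "katalan l (\<Phi> - {(Suc x, Suc y)}) M \<gamma> = 0"
        using mirror_step.prems(1) mirror_step.hyps(5) y less.prems(1)
        by (intro katalan_dot_swap_fixed[of _ _ y]) auto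
      then have 1: "katalan l \<Phi> M \<gamma> = katalan l \<Phi> M \<gamma>1"
        using katalan_remove[OF mirror_step.prems(1) mirror_step.hyps(4), of M \<gamma>] by (simp add: \<gamma>1_def)
      \<comment> \<open>Raising at \<open>(Suc x, Suc y)\<close> added 1 at \<open>x + 1\<close>,
        which turns the equality at \<open>x\<close> into the end condition of the shorter
        mirror.\<close>
      have "katalan l (\<Phi> - {(x, y)}) M \<gamma>1 = 0"
      proof (rule mirror_step.IH)
        show "\<Phi> - {(x, y)} \<subseteq> roots l" using mirror_step.prems(1) by blast
        show "\<gamma>1 x = \<gamma>1 (Suc x) - 1" using less.prems(2)[of x] xy by (simp add: \<gamma>1_def raise_def)
        show "\<gamma>1 t = \<gamma>1 (Suc t)" if "t \<in> X" for t
          using less.prems(2)[of t] \<open>\<And>t. t \<in> X \<Longrightarrow> Suc t < x\<close>[OF that] xy that by (simp add: \<gamma>1_def raise_def)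
      qed (use mirror_step.prems(2) in auto)
      then have 2: "katalan l \<Phi> M \<gamma>1 = katalan l \<Phi> M \<gamma>2"
        using katalan_remove[OF mirror_step.prems(1) mirror_step.hyps(3), of M \<gamma>1] by (simp add: \<gamma>2_def)
      have \<gamma>2: "\<gamma>2 t = \<gamma> t + of_bool (t = x \<or> t = Suc x) - of_bool (t = y \<or> t = Suc y)" for t
        using xy by (auto simp: \<gamma>2_def \<gamma>1_def raise_def)
      \<comment> \<open>Both of \<open>x\<close>, \<open>x + 1\<close> went up by 1 and both of
        \<open>y\<close>, \<open>y + 1\<close> down by 1, so all hypotheses on \<gamma> hold again
        with a smaller tail sum.\<close>
      have "katalan l \<Phi> M \<gamma>2 = 0"
      proof (rule less.hyps)
        have "?tail \<gamma>2 < ?tail \<gamma>"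
          by (rule sum_strict_mono_ex1) (use y xy in \<open>auto simp: \<gamma>2 intro!: bexI[of _ "y - 1"]\<close>)
        then show "nat (?tail \<gamma>2 + 1) < nat (?tail \<gamma> + 1)" using False by simp
        show "\<gamma>2 y = \<gamma>2 (Suc y) - 1" using less.prems(1) xy by (simp add: \<gamma>2)
        show "\<gamma>2 t = \<gamma>2 (Suc t)" if "t \<in> insert x X" for t
          using less.prems(2)[OF that] \<open>\<And>t. t \<in> X \<Longrightarrow> Suc t < x\<close>[of t] xy that by (auto simp: \<gamma>2)
      qed
      then show ?thesis using 1 2 by simp
    qed
  qed
qed

section \<open>Lowering operators along bounce paths\<close>

text \<open>The value may exceed the number of rows; row \<open>x\<close> is then empty.\<close>

definition first_col :: "nat \<Rightarrow> nat list \<Rightarrow> nat \<Rightarrow> nat" where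
  "first_col k lam x = nat (int k - part lam x + int x + 1)"

lemma mem_Delta_iff:
  "(i, j) \<in> Delta k lam \<longleftrightarrow> 1 \<le> i \<and> i < j \<and> j \<le> length lam \<and> first_col k lam i \<le> j"
  by (auto simp: Delta_def roots_def first_col_def)

lemma Pk_length: "lam \<in> Pk k l \<Longrightarrow> length lam = l"
  by (simp add: Pk_def)

lemma part_nonneg: "0 \<le> part lam x"
  by (simp add: part_def)

lemma Pk_part_le: "lam \<in> Pk k l \<Longrightarrow> part lam x \<le> int k"
  by (auto simp: Pk_def part_def)

lemma Pk_part_antimono:
  assumes "lam \<in> Pk k l" "1 \<le> a" "a \<le> b"
  shows "part lam b \<le> part lam a"
  using assms by (cases "a = b") (simp_all add: Pk_def part_def sorted_wrt_iff_nth_less)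

lemma int_first_col:
  "lam \<in> Pk k l \<Longrightarrow> int (first_col k lam x) = int k - part lam x + int x + 1"
  using Pk_part_le[of lam k l x] by (simp add: first_col_def)

lemma first_col_greater: "lam \<in> Pk k l \<Longrightarrow> x < first_col k lam x"
  using int_first_col[of lam k l x] Pk_part_le[of lam k l x] by linarith

lemma first_col_strict_mono:
  assumes "lam \<in> Pk k l" "1 \<le> a" "a < b"
  shows "first_col k lam a < first_col k lam b"
  using int_first_col[OF assms(1), of a] int_first_col[OF assms(1), of b]
    Pk_part_antimono[OF assms(1,2), of b] assms(3) by linarith

lemma first_col_le_iff:
  assumes "lam \<in> Pk k l" "1 \<le> a" "1 \<le> b"
  shows "first_col k lam a \<le> first_col k lam b \<longleftrightarrow> a \<le> b"
  using first_col_strict_mono[OF assms(1), of a b] first_col_strict_mono[OF assms(1), of b a] assms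
  by (cases a b rule: linorder_cases) auto

text \<open>Hence \<open>Delta k lam\<close> and \<open>Delta (k + 1) lam\<close> differ exactly by
  the first root of every nonempty row.\<close>

lemma first_col_Suc_k: "lam \<in> Pk k l \<Longrightarrow> first_col (k + 1) lam x = Suc (first_col k lam x)"
  using Pk_part_le[of lam k l x] unfolding first_col_def by linarith

text \<open>
  The Katalan functions interpolating between the K-k-Schur function (\<open>A = {}\<close>) and the closed
  k-Schur Katalan function (\<open>A\<close> the set of all rows).
\<close>

definition lowering_roots :: "nat \<Rightarrow> nat list \<Rightarrow> nat set \<Rightarrow> (nat \<times> nat) set" where
  "lowering_roots k lam A = Delta (k + 1) lam \<union> {p \<in> Delta k lam. fst p \<in> A}"

definition partially_closed :: "nat \<Rightarrow> nat list \<Rightarrow> nat set \<Rightarrow> symfun" where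
  "partially_closed k lam A =
     katalan (length lam) (Delta k lam) (Lset (lowering_roots k lam A)) (part lam)"

lemma partially_closed_empty: "partially_closed k lam {} = K_k_Schur k lam"
  by (simp add: partially_closed_def lowering_roots_def K_k_Schur_def)

lemma partially_closed_all:
  assumes "length lam = l"
  shows "partially_closed k lam {1..<Suc l} = closed_k_Schur_Katalan k lam"
proof -
  have "lowering_roots k lam {1..<Suc l} = Delta k lam"
    using assms by (auto simp: lowering_roots_def Delta_def roots_def)
  then show ?thesis by (simp add: partially_closed_def closed_k_Schur_Katalan_def)
qed

lemma finite_lowering_roots: "finite (lowering_roots k lam A)"
  by (simp add: lowering_roots_def finite_Delta)

lemma mem_lowering_roots:
  assumes "lam \<in> Pk k l"
  shows "(i, j) \<in> lowering_roots k lam A \<longleftrightarrow>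
    1 \<le> i \<and> j \<le> l \<and> (first_col k lam i < j \<or> i \<in> A \<and> first_col k lam i = j)"
  using first_col_greater[OF assms, of i] first_col_Suc_k[OF assms, of i]
  unfolding lowering_roots_def Un_iff mem_Collect_eq mem_Delta_iff Pk_length[OF assms] fst_conv by auto

text \<open>Opening row \<open>x\<close> adds a single lowering root, its first root
  \<open>(x, z)\<close>, and hence a single operator \<open>1 - L_z\<close>.\<close>

lemma partially_closed_insert:
  assumes lam: "lam \<in> Pk k l" and x: "1 \<le> x" "x \<notin> A" and z: "first_col k lam x = z" "z \<le> l"
  shows "partially_closed k lam (insert x A) = partially_closed k lam A -
    katalan l (Delta k lam) (Lset (lowering_roots k lam A)) ((part lam)(z := part lam z - 1))"
proof -
  have "lowering_roots k lam (insert x A) = insert (x, z) (lowering_roots k lam A)"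
    using x z by (auto simp: mem_lowering_roots[OF lam])
  moreover have "(x, z) \<notin> lowering_roots k lam A"
    using x z by (auto simp: mem_lowering_roots[OF lam])
  ultimately have "Lset (lowering_roots k lam (insert x A)) = add_mset z (Lset (lowering_roots k lam A))"
    using finite_lowering_roots[of k lam A] by (simp add: Lset_def)
  then show ?thesis by (simp add: partially_closed_def Pk_length[OF lam] katalan_add_mset)
qed

lemma partially_closed_insert_beyond:
  assumes lam: "lam \<in> Pk k l" and x: "l < first_col k lam x"
  shows "partially_closed k lam (insert x A) = partially_closed k lam A"
proof -
  have "lowering_roots k lam (insert x A) = lowering_roots k lam A"
    using x by (auto simp: mem_lowering_roots[OF lam])
  then show ?thesis by (simp add: partially_closed_def)
qed

lemma count_Lset: "finite R \<Longrightarrow> count (Lset R) y = card {i. (i, y) \<in> R}"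
proof -
  assume R: "finite R"
  have "count (Lset R) y = card {p \<in> R. y = snd p}"
    using R by (simp add: Lset_def count_image_mset')
  also have "{p \<in> R. y = snd p} = (\<lambda>i. (i, y)) ` {i. (i, y) \<in> R}" by auto
  also have "card \<dots> = card {i. (i, y) \<in> R}" by (rule card_image) (simp add: inj_on_def)
  finally show ?thesis .
qed

text \<open>The open rows lie above \<open>w\<close> and start before column \<open>y\<close>. So
  column \<open>y\<close> counts the rows starting before \<open>y\<close>, column
  \<open>y + 1\<close> those starting at \<open>y\<close> or before, and the extra one is row
  \<open>w\<close>.\<close>

lemma count_lowering_roots:
  assumes lam: "lam \<in> Pk k l" and w: "1 \<le> w" "\<And>a. a \<in> A \<Longrightarrow> a < w"
    and y: "first_col k lam w = y" "y < l"
  shows "count (Lset (lowering_roots k lam A)) (Suc y) = Suc (count (Lset (lowering_roots k lam A)) y)"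
proof -
  let ?R = "lowering_roots k lam A"
  have eq: "first_col k lam i = y \<longleftrightarrow> i = w" if "1 \<le> i" for i
    using first_col_le_iff[OF lam that w(1)] first_col_le_iff[OF lam w(1) that] y by auto
  have A: "first_col k lam i < y" if "1 \<le> i" "i \<in> A" for i
    using first_col_strict_mono[OF lam that(1) w(2)[OF that(2)]] y by simp
  have "{i. (i, Suc y) \<in> ?R} = insert w {i. (i, y) \<in> ?R}"
    using y w eq A by (auto simp: mem_lowering_roots[OF lam] less_Suc_eq dest: A)
  moreover have "w \<notin> {i. (i, y) \<in> ?R}"
    using y w by (auto simp: mem_lowering_roots[OF lam])
  moreover have "finite {i. (i, y) \<in> ?R}"
    by (rule finite_subset[OF _ finite_imageI[OF finite_lowering_roots[of k lam A], of fst]]) force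
  ultimately show ?thesis by (simp add: count_Lset finite_lowering_roots)
qed

section \<open>Lowering at a strict descent\<close>

definition lower_part :: "nat list \<Rightarrow> nat \<Rightarrow> nat list" where
  "lower_part lam z = lam[z - 1 := lam ! (z - 1) - 1]"

lemma lower_part:
  assumes lam: "lam \<in> Pk k l" and z: "1 \<le> z" "z \<le> l" and less: "part lam (Suc z) < part lam z"
  shows part_lower_part: "part (lower_part lam z) = (part lam)(z := part lam z - 1)"
    and lower_part_Pk: "lower_part lam z \<in> Pk k l"
    and sum_list_lower_part: "sum_list lam = Suc (sum_list (lower_part lam z))"
proof -
  have l: "length lam = l" using lam by (rule Pk_length)
  have pos: "0 < lam ! (z - 1)" using less z l part_nonneg[of lam "Suc z"] by (auto simp: part_def)
  show eq: "part (lower_part lam z) = (part lam)(z := part lam z - 1)"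
    using z l pos by (auto simp: fun_eq_iff part_def lower_part_def nth_list_update)
  have len: "length (lower_part lam z) = l" by (simp add: lower_part_def l)
  have nth: "int (lower_part lam z ! i) = part (lower_part lam z) (Suc i)" if "i < l" for i
    using that len by (simp add: part_def)
  have "lower_part lam z ! j \<le> lower_part lam z ! i" if "i < j" "j < l" for i j
  proof -
    have "part lam (Suc j) \<le> part lam (Suc i)" "z = Suc i \<Longrightarrow> part lam (Suc j) \<le> part lam (Suc z)"
      using that by (auto intro!: Pk_part_antimono[OF lam])
    then have "int (lower_part lam z ! j) \<le> int (lower_part lam z ! i)"
      using that less by (auto simp: nth eq)
    then show ?thesis by simp
  qed
  moreover have "lower_part lam z ! i \<le> k" if "i < l" for i
  proof -
    have "int (lower_part lam z ! i) \<le> int k"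
      using that Pk_part_le[OF lam, of "Suc i"] Pk_part_le[OF lam, of z] by (auto simp: nth eq)
    then show ?thesis by simp
  qed
  ultimately show "lower_part lam z \<in> Pk k l"
    by (auto simp: Pk_def len sorted_wrt_iff_nth_less in_set_conv_nth)
  show "sum_list lam = Suc (sum_list (lower_part lam z))"
  proof -
    have "z - 1 < length lam" using z l by simp
    then show ?thesis
      using pos elem_le_sum_list[of "z - 1" lam] by (simp add: lower_part_def sum_list_update)
  qed
qed

lemma first_col_lower_part:
  assumes lam: "lam \<in> Pk k l" and z: "1 \<le> z" "z \<le> l" and less: "part lam (Suc z) < part lam z"
  shows "first_col k (lower_part lam z) x = (if x = z then Suc (first_col k lam z) else first_col k lam x)"
proof (cases "x = z")
  case True
  have "int (first_col k (lower_part lam z) z) = int (Suc (first_col k lam z))"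
    using int_first_col[OF lam, of z] int_first_col[OF lower_part_Pk[OF assms], of z]
    by (simp add: part_lower_part[OF assms])
  with True show ?thesis by simp
qed (simp add: part_lower_part[OF assms] first_col_def)

text \<open>Remove the first root \<open>(z, b)\<close> of row \<open>z\<close>. What remains
  belongs to the lowered partition, whose row \<open>z\<close> starts one column later; the raised
  term has \<open>lam\<close> lowered at \<open>b\<close>, which is what opening row
  \<open>z\<close> of \<open>lam\<close> subtracts.\<close>

lemma katalan_lower_strict:
  assumes lam: "lam \<in> Pk k l" and z: "1 \<le> z" "z \<le> l" "z \<notin> A" and less: "part lam (Suc z) < part lam z"
  shows "katalan l (Delta k lam) (Lset (lowering_roots k lam A)) ((part lam)(z := part lam z - 1)) =
    partially_closed k (lower_part lam z) (insert z A) +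
    partially_closed k lam A - partially_closed k lam (insert z A)"
proof -
  let ?mu = "lower_part lam z" and ?L = "Lset (lowering_roots k lam A)"
  define b where "b = first_col k lam z"
  note mu = lower_part[OF lam z(1,2) less]
  note col = first_col_lower_part[OF lam z(1,2) less]
  have zb: "z < b" using first_col_greater[OF lam] by (simp add: b_def)
  have Delta: "Delta k ?mu = Delta k lam - {(z, b)}"
    by (auto simp: mem_Delta_iff Pk_length[OF lam] Pk_length[OF mu(2)] col b_def split: if_splits)
  \<comment> \<open>Unopened, row \<open>z\<close> of \<open>lam\<close> has its lowering roots
    right of column \<open>b\<close>; opened, row \<open>z\<close> of \<open>?mu\<close> has them
    from its start \<open>b + 1\<close> on.\<close>
  have "lowering_roots k ?mu (insert z A) = lowering_roots k lam A"
    using z by (auto simp: mem_lowering_roots[OF lam] mem_lowering_roots[OF mu(2)] col split: if_splits)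
  then have closed_mu: "partially_closed k ?mu (insert z A) =
      katalan l (Delta k lam - {(z, b)}) ?L ((part lam)(z := part lam z - 1))"
    by (simp add: partially_closed_def Pk_length[OF mu(2)] mu(1) Delta)
  show ?thesis
  proof (cases "b \<le> l")
    case True
    have "(z, b) \<in> Delta k lam" using True z zb by (simp add: mem_Delta_iff Pk_length[OF lam] b_def)
    moreover have "raise (z, b) ((part lam)(z := part lam z - 1)) = (part lam)(b := part lam b - 1)"
      using zb by (auto simp: raise_def fun_eq_iff)
    ultimately show ?thesis
      using katalan_remove[of "Delta k lam" l "(z, b)" ?L "(part lam)(z := part lam z - 1)"]
        Delta_subset_roots[of k lam] partially_closed_insert[OF lam z(1,3) b_def[symmetric] True]
      by (simp only: closed_mu Pk_length[OF lam]) simp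
  next
    case False
    then have "Delta k lam - {(z, b)} = Delta k lam" by (auto simp: mem_Delta_iff Pk_length[OF lam])
    moreover have "partially_closed k lam (insert z A) = partially_closed k lam A"
      using False by (intro partially_closed_insert_beyond[OF lam]) (simp add: b_def)
    ultimately show ?thesis by (simp only: closed_mu) simp
  qed
qed

section \<open>Bounce paths, mirrors along them, and lowering between equal parts\<close>

inductive bounce :: "nat \<Rightarrow> nat list \<Rightarrow> nat \<Rightarrow> nat \<Rightarrow> bool" for k lam i where
  bounce_refl: "bounce k lam i i"
| bounce_step: "bounce k lam i x \<Longrightarrow> first_col k lam x \<le> length lam \<Longrightarrow> bounce k lam i (first_col k lam x)"

lemma bounce_ge: "bounce k lam i x \<Longrightarrow> lam \<in> Pk k l \<Longrightarrow> i \<le> x"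
proof (induction rule: bounce.induct)
  case (bounce_step x)
  then show ?case using first_col_greater[of lam k l x] by simp
qed simp

text \<open>The path up to \<open>x\<close> reads only rows before \<open>x\<close>, so it survives
  shortening row \<open>x\<close> or a later one.\<close>

lemma bounce_cong:
  assumes "bounce k lam i x" "lam \<in> Pk k l" "length mu = l"
    and "\<And>y. y < x \<Longrightarrow> first_col k mu y = first_col k lam y"
  shows "bounce k mu i x"
  using assms
proof (induction rule: bounce.induct)
  case bounce_refl
  show ?case by (rule bounce.bounce_refl)
next
  case (bounce_step x)
  have "x < first_col k lam x" by (rule first_col_greater[OF bounce_step.prems(1)])
  with bounce_step have "bounce k mu i x" "first_col k mu x = first_col k lam x" by simp_all
  with bounce_step show ?case
    using bounce.bounce_step[of k mu i x] by (simp add: Pk_length[OF bounce_step.prems(1)])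
qed

lemma swap_invariantI:
  assumes \<Phi>: "\<Phi> \<subseteq> roots l" and rows: "\<And>b. (y, b) \<in> \<Phi> \<longleftrightarrow> (Suc y, b) \<in> \<Phi>"
    and cols: "\<And>a. a < y \<Longrightarrow> (a, y) \<in> \<Phi> \<longleftrightarrow> (a, Suc y) \<in> \<Phi>"
  shows "swap_invariant y \<Phi>"
  unfolding swap_invariant_def
proof safe
  fix a b assume ab: "(a, b) \<in> \<Phi>"
  then have less: "a < b" using \<Phi> by (auto simp: roots_def)
  \<comment> \<open>Otherwise the equal rows would put \<open>(Suc y, Suc y)\<close> into \<Phi>,
    which is no root.\<close>
  have "(y, Suc y) \<notin> \<Phi>" using rows[of "Suc y"] \<Phi> by (auto simp: roots_def)
  with ab have "(a, b) \<noteq> (y, Suc y)" by blast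
  then consider "a < y" | "a = y" "Suc y < b" | "a = Suc y" "Suc y < b" | "Suc y < a" "Suc y < b"
    using less by fastforce
  then show "root_swap y (a, b) \<in> \<Phi>"
    by cases (use ab rows cols in \<open>auto simp: root_swap_def transpose_def\<close>)
qed

text \<open>Let row \<open>x\<close> start at \<open>y\<close>. If row \<open>x + 1\<close> starts
  beyond \<open>y + 1\<close>, columns \<open>y\<close> and \<open>y + 1\<close> agree above row
  \<open>y\<close> and the mirror ends. If it starts at \<open>y + 1\<close>, this root alone breaks
  the symmetry and the mirror continues one step back, at \<open>x\<close>. The drop of
  \<open>lam\<close> at \<open>i\<close> forces the first case at the start of the path.\<close>

lemma bounce_mirror:
  assumes lam: "lam \<in> Pk k l" and i: "1 \<le> i" "first_col k lam i < l \<Longrightarrow> part lam (Suc i) < part lam i"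
    and "bounce k lam i x" and "first_col k lam x < l" and "\<Phi> \<subseteq> roots l"
    and "\<And>a b. a < first_col k lam x \<Longrightarrow> (a, b) \<in> \<Phi> \<longleftrightarrow> (a, b) \<in> Delta k lam"
    and "\<And>b. (first_col k lam x, b) \<in> \<Phi> \<longleftrightarrow> (Suc (first_col k lam x), b) \<in> \<Phi>"
  shows "\<exists>X. mirror \<Phi> (first_col k lam x) X \<and>
    (\<forall>t\<in>X. part lam t = part lam (Suc t) \<and> (\<exists>w\<ge>i. t = first_col k lam w))"
  using assms(4-)
proof (induction arbitrary: \<Phi> rule: bounce.induct)
  have strict: "swap_invariant (first_col k lam x) \<Phi>"
    if x: "part lam (Suc x) < part lam x" "1 \<le> x" and y: "first_col k lam x < l" and \<Phi>: "\<Phi> \<subseteq> roots l"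
      and agree: "\<And>a b. a < first_col k lam x \<Longrightarrow> (a, b) \<in> \<Phi> \<longleftrightarrow> (a, b) \<in> Delta k lam"
      and rows: "\<And>b. (first_col k lam x, b) \<in> \<Phi> \<longleftrightarrow> (Suc (first_col k lam x), b) \<in> \<Phi>" for x \<Phi>
  proof (rule swap_invariantI[OF \<Phi> rows])
    fix a assume a: "a < first_col k lam x"
    have "Suc (first_col k lam x) < first_col k lam (Suc x)"
      using int_first_col[OF lam, of x] int_first_col[OF lam, of "Suc x"] x(1) by linarith
    then have "first_col k lam a \<le> Suc (first_col k lam x) \<longleftrightarrow> first_col k lam a \<le> first_col k lam x"
      if "1 \<le> a" using first_col_le_iff[OF lam _ that, of "Suc x"] first_col_le_iff[OF lam that x(2)] by auto
    with a y show "(a, first_col k lam x) \<in> \<Phi> \<longleftrightarrow> (a, Suc (first_col k lam x)) \<in> \<Phi>"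
      by (auto simp: agree mem_Delta_iff Pk_length[OF lam])
  qed
  {
    case bounce_refl
    then have "mirror \<Phi> (first_col k lam i) {}" by (intro mirror_base strict i) auto
    then show ?case by blast
  next
    case (bounce_step w)
    define x where "x = first_col k lam w"
    define y where "y = first_col k lam x"
    note prems = bounce_step.prems[folded x_def, folded y_def]
    have w: "i \<le> w" by (rule bounce_ge[OF bounce_step.hyps(1) lam])
    have wx: "w < x" unfolding x_def by (rule first_col_greater[OF lam])
    have xy: "x < y" unfolding y_def by (rule first_col_greater[OF lam])
    show ?case
    proof (cases "part lam (Suc x) < part lam x")
      case True
      then have "mirror \<Phi> y {}"
        unfolding y_def using wx by (intro mirror_base strict prems[unfolded y_def]) auto
      then show ?thesis unfolding y_def x_def by blast
    next
      case False
      then have eq: "part lam x = part lam (Suc x)" using Pk_part_antimono[OF lam, of x "Suc x"] wx by auto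
      have y': "first_col k lam (Suc x) = Suc y"
        using int_first_col[OF lam, of x] int_first_col[OF lam, of "Suc x"] eq y_def by linarith
      have "first_col k lam i < l"
        using first_col_le_iff[OF lam i(1), of x] i(1) w wx prems(1) y_def by auto
      \<comment> \<open>The drop at \<open>i\<close> gives \<open>part lam x < k\<close>, so row
        \<open>x\<close> starts at least two columns after \<open>x\<close> and row
        \<open>x + 1\<close> is still among those where \<Phi> agrees with the diagram.\<close>
      then have "part lam (Suc i) < part lam i" by (rule i)
      moreover have "part lam x \<le> part lam (Suc i)" using w wx by (intro Pk_part_antimono[OF lam]) auto
      ultimately have Suc_x: "Suc x < y"
        using int_first_col[OF lam, of x] Pk_part_le[OF lam, of i] y_def by linarith
      have row: "(x, b) \<in> \<Phi> \<longleftrightarrow> y \<le> b \<and> b \<le> l" "(Suc x, b) \<in> \<Phi> \<longleftrightarrow> Suc y \<le> b \<and> b \<le> l" for b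
        using prems(3)[of x b] prems(3)[of "Suc x" b] xy wx Suc_x y'
        by (auto simp: mem_Delta_iff Pk_length[OF lam] y_def)
      \<comment> \<open>Without \<open>(x, y)\<close>, rows \<open>x\<close> and
        \<open>x + 1\<close> both occupy the columns \<open>y + 1\<close> to \<open>l\<close>, as
        the induction hypothesis requires.\<close>
      have "\<exists>X. mirror (\<Phi> - {(x, y)}) x X \<and> (\<forall>t\<in>X. part lam t = part lam (Suc t) \<and> (\<exists>w\<ge>i. t = first_col k lam w))"
        unfolding x_def
      proof (rule bounce_step.IH; fold x_def)
        show "x < l" using xy prems(1) by simp
        show "\<Phi> - {(x, y)} \<subseteq> roots l" using prems(2) by blast
        show "(a, b) \<in> \<Phi> - {(x, y)} \<longleftrightarrow> (a, b) \<in> Delta k lam" if "a < x" for a b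
          using prems(3)[of a b] that xy by auto
        show "(x, b) \<in> \<Phi> - {(x, y)} \<longleftrightarrow> (Suc x, b) \<in> \<Phi> - {(x, y)}" for b
          using row by auto
      qed
      then obtain X where X: "mirror (\<Phi> - {(x, y)}) x X"
        "\<forall>t\<in>X. part lam t = part lam (Suc t) \<and> (\<exists>w\<ge>i. t = first_col k lam w)" by blast
      have "mirror \<Phi> y (insert x X)"
      proof (rule mirror_step[OF X(1) Suc_x])
        show "(x, y) \<in> \<Phi>" "(Suc x, Suc y) \<in> \<Phi>" using prems(1) by (auto simp: row)
        show "swap_invariant y (\<Phi> - {(Suc x, Suc y)})"
        proof (rule swap_invariantI)
          show "\<Phi> - {(Suc x, Suc y)} \<subseteq> roots l" using prems(2) by blast
          show "(y, b) \<in> \<Phi> - {(Suc x, Suc y)} \<longleftrightarrow> (Suc y, b) \<in> \<Phi> - {(Suc x, Suc y)}" for b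
            using prems(4)[of b] Suc_x by auto
          fix a assume a: "a < y"
          \<comment> \<open>Row \<open>x + 1\<close> is the only one that starts in column
            \<open>y + 1\<close>.\<close>
          have "first_col k lam a \<le> Suc y \<and> a \<noteq> Suc x \<longleftrightarrow> first_col k lam a \<le> y" if "1 \<le> a"
            using first_col_le_iff[OF lam that, of "Suc x"] first_col_le_iff[OF lam that, of x] wx
            by (auto simp: y' y_def[symmetric])
          with a prems(1,3) show "(a, y) \<in> \<Phi> - {(Suc x, Suc y)} \<longleftrightarrow> (a, Suc y) \<in> \<Phi> - {(Suc x, Suc y)}"
            by (auto simp: mem_Delta_iff Pk_length[OF lam])
        qed
      qed
      moreover have "\<forall>t\<in>insert x X. part lam t = part lam (Suc t) \<and> (\<exists>w\<ge>i. t = first_col k lam w)"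
        using X(2) eq w by (auto simp: x_def)
      ultimately show ?thesis unfolding y_def x_def by blast
    qed
  }
qed

text \<open>The root \<open>(z, b)\<close> is removed as at a strict descent, but now the lowered
  weight is no partition: for \<open>z < l\<close> it is fixed by the dot action at
  \<open>z\<close>, and the function without \<open>(z, b)\<close> vanishes by the mirror along the
  bounce path.\<close>

lemma katalan_lower_equal:
  assumes lam: "lam \<in> Pk k l" and i: "1 \<le> i" "first_col k lam i < l \<Longrightarrow> part lam (Suc i) < part lam i"
    and bounce: "bounce k lam i x" and z: "first_col k lam x = z" "z \<le> l"
    and eq: "part lam z = part lam (Suc z)" and A: "\<And>a. a \<in> A \<Longrightarrow> a < i"
  shows "katalan l (Delta k lam) (Lset (lowering_roots k lam A)) ((part lam)(z := part lam z - 1)) =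
    partially_closed k lam A - partially_closed k lam (insert z A)"
proof -
  let ?L = "Lset (lowering_roots k lam A)" and ?\<gamma> = "(part lam)(z := part lam z - 1)"
  define b where "b = first_col k lam z"
  have ix: "i \<le> x" by (rule bounce_ge[OF bounce lam])
  have xz: "x < z" using first_col_greater[OF lam, of x] z by simp
  have zb: "z < b" using first_col_greater[OF lam, of z] by (simp add: b_def)
  have zA: "z \<notin> A" using A[of z] ix xz by auto
  have D: "Delta k lam \<subseteq> roots l" using Delta_subset_roots[of k lam] by (simp add: Pk_length[OF lam])
  have beyond: "partially_closed k lam (insert z A) = partially_closed k lam A" if "l < b"
    using that by (intro partially_closed_insert_beyond[OF lam]) (simp add: b_def)
  show ?thesis
  proof (cases "z = l")
    case True
    \<comment> \<open>\<open>part\<close> is 0 beyond \<open>l\<close>, so the last part is 0 as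
      well and lowering it makes the last tail sum negative.\<close>
    have "part lam (Suc l) = 0" by (simp add: part_def Pk_length[OF lam])
    moreover have "{l - 1..<l} = {l - 1}" using xz True by auto
    ultimately have "(\<Sum>t\<in>{l - 1..<l}. ?\<gamma> (t + 1)) < 0" using True xz eq by auto
    then have "katalan l (Delta k lam) ?L ?\<gamma> = 0" using katalan_nonzero_tail[OF D] by (meson not_le)
    then show ?thesis using beyond zb True by simp
  next
    case False
    with z have zl: "z < l" by simp
    \<comment> \<open>Row \<open>z + 1\<close> starts one column after row \<open>z\<close>, so
      removing \<open>(z, b)\<close> makes the two rows equal.\<close>
    have "first_col k lam (Suc z) = Suc b"
      using int_first_col[OF lam, of z] int_first_col[OF lam, of "Suc z"] eq b_def by linarith
    then have "(z, c) \<in> Delta k lam - {(z, b)} \<longleftrightarrow> (Suc z, c) \<in> Delta k lam - {(z, b)}" for c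
      using xz zb by (auto simp: mem_Delta_iff b_def[symmetric])
    moreover have "(a, c) \<in> Delta k lam - {(z, b)} \<longleftrightarrow> (a, c) \<in> Delta k lam" if "a < z" for a c
      using that by auto
    ultimately obtain X where X: "mirror (Delta k lam - {(z, b)}) z X"
      "\<And>t. t \<in> X \<Longrightarrow> part lam t = part lam (Suc t) \<and> (\<exists>w\<ge>i. t = first_col k lam w)"
      using bounce_mirror[OF lam i bounce, of "Delta k lam - {(z, b)}"] zl D
      unfolding z(1) by blast
    have vanish: "katalan l (Delta k lam - {(z, b)}) ?L ?\<gamma> = 0"
    proof (rule katalan_mirror[OF X(1)])
      show "Delta k lam - {(z, b)} \<subseteq> roots l" using D by blast
      show "?\<gamma> z = ?\<gamma> (Suc z) - 1" using eq by simp
      show "?\<gamma> t = ?\<gamma> (Suc t)" if "t \<in> X" for t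
        using X(2)[OF that] mirror_less[OF X(1) that] by simp
      fix t assume t: "t \<in> insert z X"
      \<comment> \<open>Each such \<open>t\<close> is the start of a row \<open>w\<close> below all
        open rows, which is what the column count needs.\<close>
      then obtain w where w: "i \<le> w" "t = first_col k lam w" using X(2) z ix by blast
      have "t < l" using t mirror_less[OF X(1)] zl by fastforce
      moreover have "w < t" using w first_col_greater[OF lam] by simp
      ultimately show "1 \<le> t \<and> t < l \<and> count ?L (Suc t) = Suc (count ?L t)"
        using w i(1) A by (auto intro!: count_lowering_roots[OF lam, of w] dest!: A)
    qed
    show ?thesis
    proof (cases "b \<le> l")
      case True
      have "(z, b) \<in> Delta k lam" using True xz zb by (simp add: mem_Delta_iff Pk_length[OF lam] b_def)
      moreover have "raise (z, b) ?\<gamma> = (part lam)(b := part lam b - 1)"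
        using zb by (auto simp: raise_def fun_eq_iff)
      ultimately show ?thesis
        using katalan_remove[OF D, of "(z, b)" ?L ?\<gamma>] vanish xz
          partially_closed_insert[OF lam _ zA b_def[symmetric] True]
        by simp
    next
      case False
      then have "Delta k lam - {(z, b)} = Delta k lam" by (auto simp: mem_Delta_iff Pk_length[OF lam])
      then show ?thesis using vanish beyond False by simp
    qed
  qed
qed

section \<open>Alternating expansions\<close>

text \<open>\<open>n\<close> stands for the size of the expanded partition;
  \<open>n + sum_list mu\<close> has the parity of the difference of sizes.\<close>

definition alternating :: "nat \<Rightarrow> nat \<Rightarrow> symfun \<Rightarrow> bool" where
  "alternating k n f \<longleftrightarrow> (\<exists>b :: nat list \<Rightarrow> int. finite {mu. b mu \<noteq> 0} \<and>
     {mu. b mu \<noteq> 0} \<subseteq> bounded_partitions k \<and>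
     f = (\<Sum>mu | b mu \<noteq> 0. of_int (b mu) * K_k_Schur k mu) \<and>
     (\<forall>mu. 0 \<le> (-1) ^ (n + sum_list mu) * b mu))"

lemma alternatingE:
  assumes "alternating k n f"
  obtains b :: "nat list \<Rightarrow> int" where "finite {mu. b mu \<noteq> 0}" "{mu. b mu \<noteq> 0} \<subseteq> bounded_partitions k"
    "f = (\<Sum>mu | b mu \<noteq> 0. of_int (b mu) * K_k_Schur k mu)"
    "\<forall>mu. 0 \<le> (-1) ^ (n + sum_list mu) * b mu"
  by (rule alternating_def[THEN iffD1, OF assms, THEN exE]) (elim conjE, rule that)

text \<open>Subtraction flips the signs of \<open>g\<close>, which matches the change of parity from
  \<open>n\<close> to \<open>Suc n\<close>.\<close>

lemma alternating_diff:
  assumes "alternating k (Suc n) f" "alternating k n g"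
  shows "alternating k (Suc n) (f - g)"
proof -
  obtain b where b: "finite {mu. b mu \<noteq> 0}" "{mu. b mu \<noteq> 0} \<subseteq> bounded_partitions k"
    "f = (\<Sum>mu | b mu \<noteq> 0. of_int (b mu) * K_k_Schur k mu)"
    "\<forall>mu. 0 \<le> (-1) ^ (Suc n + sum_list mu) * b mu"
    using assms(1) by (rule alternatingE)
  obtain c where c: "finite {mu. c mu \<noteq> 0}" "{mu. c mu \<noteq> 0} \<subseteq> bounded_partitions k"
    "g = (\<Sum>mu | c mu \<noteq> 0. of_int (c mu) * K_k_Schur k mu)"
    "\<forall>mu. 0 \<le> (-1) ^ (n + sum_list mu) * c mu"
    using assms(2) by (rule alternatingE)
  define d where "d mu = b mu - c mu" for mu
  define N where "N = {mu. b mu \<noteq> 0} \<union> {mu. c mu \<noteq> 0}"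
  have N: "finite N" "N \<subseteq> bounded_partitions k" using b c by (auto simp: N_def)
  have expand: "(\<Sum>mu | e mu \<noteq> 0. of_int (e mu) * K_k_Schur k mu) = (\<Sum>mu\<in>N. of_int (e mu) * K_k_Schur k mu)"
    if "{mu. e mu \<noteq> 0} \<subseteq> N" for e :: "nat list \<Rightarrow> int"
    using that N by (intro sum.mono_neutral_left) auto
  have sub: "{mu. d mu \<noteq> 0} \<subseteq> N" by (auto simp: d_def N_def)
  have "f - g = (\<Sum>mu\<in>N. of_int (d mu) * K_k_Schur k mu)"
    unfolding b(3) c(3) d_def by (subst (1 2) expand) (auto simp: N_def left_diff_distrib sum_subtractf)
  also have "\<dots> = (\<Sum>mu | d mu \<noteq> 0. of_int (d mu) * K_k_Schur k mu)"
    using expand[OF sub] by simp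
  finally have "f - g = (\<Sum>mu | d mu \<noteq> 0. of_int (d mu) * K_k_Schur k mu)" .
  moreover have "0 \<le> (-1) ^ (Suc n + sum_list mu) * d mu" for mu
    using b(4)[rule_format, of mu] c(4)[rule_format, of mu] by (simp add: d_def right_diff_distrib)
  moreover have "finite {mu. d mu \<noteq> 0}" "{mu. d mu \<noteq> 0} \<subseteq> bounded_partitions k"
    using sub N finite_subset by blast+
  ultimately show ?thesis unfolding alternating_def by (intro exI[of _ d]) simp
qed

lemma decreasing_strip_zeros:
  fixes lam :: "nat list"
  assumes "sorted_wrt (\<ge>) lam"
  shows "\<exists>m. lam = filter (\<lambda>x. x \<noteq> 0) lam @ replicate m 0"
  using assms
proof (induction lam)
  case (Cons a lam)
  then obtain m where m: "lam = filter (\<lambda>x. x \<noteq> 0) lam @ replicate m 0" by auto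
  show ?case
  proof (cases "a = 0")
    case True
    with Cons.prems have "\<forall>x\<in>set lam. x = 0" by auto
    then have "lam = replicate (length lam) 0" "filter (\<lambda>x. x \<noteq> 0) lam = []"
      by (auto simp: filter_empty_conv intro: replicate_eqI)
    with True show ?thesis by (auto intro!: exI[of _ "Suc (length lam)"])
  qed (use m in auto)
qed simp

text \<open>The expansion is a single term; trailing zeros are stripped because
  \<open>bounded_partitions\<close> has lists of positive parts only.\<close>

lemma alternating_K_k_Schur:
  assumes "lam \<in> Pk k l"
  shows "alternating k (sum_list lam) (K_k_Schur k lam)"
proof -
  define mu where "mu = filter (\<lambda>x. x \<noteq> 0) lam"
  obtain m where m: "lam = mu @ replicate m 0"
    using assms decreasing_strip_zeros[of lam] by (auto simp: Pk_def mu_def)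
  have "mu \<in> bounded_partitions k"
    using assms by (auto simp: mu_def bounded_partitions_def Pk_def sorted_wrt_filter)
  moreover have "sum_list lam = sum_list mu" "K_k_Schur k lam = K_k_Schur k mu"
    by (simp_all add: m K_k_Schur_pad sum_list_replicate)
  ultimately show ?thesis
    unfolding alternating_def by (intro exI[of _ "\<lambda>nu. of_bool (nu = mu)"]) auto
qed

text \<open>
  The rows are opened one at a time from the bottom; opening row \<open>i\<close> pushes the extra lowering
  operator along the bounce path of \<open>i\<close> until it leaves the diagram. Only rows below \<open>i\<close> are
  shortened on the way, so the strictness hypothesis for the rows above \<open>i\<close> persists.
\<close>

lemma alternating_partially_closed:
  assumes "lam \<in> Pk k l"
    and "\<And>j. 1 \<le> j \<Longrightarrow> j < i \<Longrightarrow> first_col k lam j < l \<Longrightarrow> part lam (Suc j) < part lam j"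
  shows "alternating k (sum_list lam) (partially_closed k lam {1..<i})"
  using assms
proof (induction i arbitrary: lam)
  case 0
  then show ?case by (simp add: partially_closed_empty alternating_K_k_Schur)
next
  case (Suc i)
  show ?case
  proof (cases "i = 0")
    case True
    then show ?thesis using Suc.prems(1) by (simp add: partially_closed_empty alternating_K_k_Schur)
  next
    case False
    \<comment> \<open>The extra operator has reached row \<open>x\<close> on the bounce path of
      \<open>i\<close>. The partition is generalized too, since it may be lowered on the
      way.\<close>
    have "alternating k (sum_list lam) (partially_closed k lam (insert x {1..<i}))"
      if "bounce k lam i x" "lam \<in> Pk k l"
        "\<And>j. 1 \<le> j \<Longrightarrow> j < Suc i \<Longrightarrow> first_col k lam j < l \<Longrightarrow> part lam (Suc j) < part lam j" for x lam
      using that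
    proof (induction "l - x" arbitrary: x lam rule: less_induct)
      case less
      note lam = less.prems(2)
      define z where "z = first_col k lam x"
      have ix: "i \<le> x" by (rule bounce_ge[OF less.prems(1) lam])
      have xz: "x < z" unfolding z_def by (rule first_col_greater[OF lam])
      show ?case
      proof (cases "z \<le> l")
        case False
        \<comment> \<open>The path has left the diagram: row \<open>x\<close> is empty, and the
          outer induction hypothesis for the rows above \<open>i\<close> takes over.\<close>
        then have "partially_closed k lam (insert x {1..<i}) = partially_closed k lam {1..<i}"
          by (intro partially_closed_insert_beyond[OF lam]) (simp add: z_def)
        then show ?thesis using Suc.IH[OF lam] less.prems(3) by simp
      next
        case True
        have insert_x: "partially_closed k lam (insert x {1..<i}) = partially_closed k lam {1..<i} -
            katalan l (Delta k lam) (Lset (lowering_roots k lam {1..<i})) ((part lam)(z := part lam z - 1))"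
          using ix \<open>i \<noteq> 0\<close> True by (intro partially_closed_insert[OF lam]) (auto simp: z_def)
        have "bounce k lam i z"
          unfolding z_def by (rule bounce_step[OF less.prems(1)]) (use True z_def Pk_length[OF lam] in simp)
        then have push: "alternating k (sum_list lam) (partially_closed k lam (insert z {1..<i}))"
          using less.hyps[of z lam] less.prems xz True by simp
        show ?thesis
        proof (cases "part lam (Suc z) < part lam z")
          case strict: True
          let ?mu = "lower_part lam z"
          have z: "1 \<le> z" "z \<notin> {1..<i}" using ix xz by auto
          note mu = lower_part[OF lam z(1) True strict]
          note col = first_col_lower_part[OF lam z(1) True strict]
          \<comment> \<open>The operator branches: it moves on to \<open>z\<close> both for
            \<open>lam\<close> and for the partition of size one less, which enters with a minus
            sign.\<close>
          have "partially_closed k lam (insert x {1..<i}) =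
              partially_closed k lam (insert z {1..<i}) - partially_closed k ?mu (insert z {1..<i})"
            using insert_x katalan_lower_strict[OF lam z(1) True z(2) strict] by simp
          moreover have "alternating k (sum_list ?mu) (partially_closed k ?mu (insert z {1..<i}))"
          proof (rule less.hyps)
            show "l - z < l - x" using xz True by simp
            have "bounce k ?mu i x"
              by (rule bounce_cong[OF less.prems(1) lam]) (use Pk_length[OF mu(2)] col xz in auto)
            then have "bounce k ?mu i (first_col k ?mu x)"
              by (rule bounce_step) (use True xz col z_def Pk_length[OF mu(2)] in auto)
            then show "bounce k ?mu i z" using xz col by (simp add: z_def)
            \<comment> \<open>Here \<open>j\<close> is at most \<open>i\<close> and so less than
              \<open>z\<close>; lowering part \<open>z\<close> can only widen a drop at
              \<open>z - 1\<close>.\<close>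
            show "part ?mu (Suc j) < part ?mu j" if "1 \<le> j" "j < Suc i" "first_col k ?mu j < l" for j
              using less.prems(3)[of j] that ix xz by (auto simp: mu(1) col)
          qed (rule mu(2))
          ultimately show ?thesis using push alternating_diff mu(3) by metis
        next
          case False
          then have eq: "part lam z = part lam (Suc z)"
            using Pk_part_antimono[OF lam, of z "Suc z"] xz by auto
          have "partially_closed k lam (insert x {1..<i}) = partially_closed k lam (insert z {1..<i})"
            using insert_x katalan_lower_equal[OF lam _ _ less.prems(1) z_def[symmetric] True eq, of "{1..<i}"]
              \<open>i \<noteq> 0\<close> less.prems(3)[of i] by simp
          then show ?thesis using push by simp
        qed
      qed
    qed
    from this[OF bounce_refl Suc.prems] show ?thesis
      using False by (simp add: atLeastLessThanSuc)
  qed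
qed

theorem theorem1p3:
  fixes k l :: nat and lam :: "nat list"
  assumes "1 \<le> k" and "1 \<le> l" and "lam \<in> Pk_hat k l"
  shows "\<exists>b :: nat list \<Rightarrow> int.
    finite {mu \<in> bounded_partitions k. b mu \<noteq> 0} \<and>
    closed_k_Schur_Katalan k lam =
      (\<Sum>mu | mu \<in> bounded_partitions k \<and> b mu \<noteq> 0. of_int (b mu) * K_k_Schur k mu) \<and>
    (\<forall>mu \<in> bounded_partitions k.
       0 \<le> (-1) ^ nat \<bar>int (sum_list lam) - int (sum_list mu)\<bar> * b mu)"
proof -
  have lam: "lam \<in> Pk k l" using assms(3) by (simp add: Pk_hat_def)
  have "part lam (Suc j) < part lam j" if j: "1 \<le> j" "first_col k lam j < l" for j
  proof (rule ccontr)
    assume "\<not> ?thesis"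
    then have eq: "part lam (Suc j) = part lam j" using Pk_part_antimono[OF lam j(1), of "Suc j"] by simp
    have "Suc j \<in> {2..l}" using j first_col_greater[OF lam, of j] by simp
    \<comment> \<open>By the assumed equality the left side is \<open>first_col k lam j\<close>, so
      the condition in \<open>Pk_hat\<close> applies at \<open>Suc j\<close>.\<close>
    moreover have "int k - part lam (Suc j) + int (Suc j) < int l"
      using int_first_col[OF lam, of j] j(2) eq by simp
    ultimately have "part lam (Suc j) < part lam (Suc j - 1)"
      using assms(3) unfolding Pk_hat_def by blast
    with eq show False by simp
  qed
  then have "alternating k (sum_list lam) (closed_k_Schur_Katalan k lam)"
    using alternating_partially_closed[OF lam, of "Suc l"] partially_closed_all[OF Pk_length[OF lam]] by simp
  then obtain b where b: "finite {mu. b mu \<noteq> 0}" "{mu. b mu \<noteq> 0} \<subseteq> bounded_partitions k"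
    "closed_k_Schur_Katalan k lam = (\<Sum>mu | b mu \<noteq> 0. of_int (b mu) * K_k_Schur k mu)"
    "\<forall>mu. 0 \<le> (-1) ^ (sum_list lam + sum_list mu) * b mu"
    by (rule alternatingE)
  have "{mu. mu \<in> bounded_partitions k \<and> b mu \<noteq> 0} = {mu. b mu \<noteq> 0}" using b(2) by blast
  moreover have "(-1 :: int) ^ nat \<bar>int m - int n\<bar> = (-1) ^ (m + n)" for m n :: nat
    by (simp add: minus_one_power_iff even_nat_iff)
  ultimately show ?thesis using b by (intro exI[of _ b]) auto
qed

end
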